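(* For every modal formula $A$ and label $x$: if $\mathsf{PIGL}\models A$ then $\mathsf{mlabIGL}\vdash x:A$.
   Context: Metatheory: ZFC plus lightface analytic determinacy (equivalently, existence of $0^\#$). Modal formulas: $A ::= p \mid \bot \mid A\wedge A \mid A \vee A \mid A \to A \mid \Box A \mid \Diamond A$. Labelled sequents $\mathcal R,\Gamma\Rightarrow\Delta$ with $\mathcal R$ a set of relational atoms $xRy$ and $\Gamma,\Delta$ multisets of labelled formulas $x:A$. $\mathsf{labK4}$ rules (premisses / conclusion): id $\mathcal R,x:p\Rightarrow x:p$; $\bot$L $\mathcal R,x:\bot,\Gamma\Rightarrow\Delta$; cut: $\mathcal R,\Gamma\Rightarrow\Delta,x:A$ and $\mathcal R,\Gamma',x:A\Rightarrow\Delta'$ / $\mathcal R,\Gamma,\Gamma'\Rightarrow\Delta,\Delta'$; left/right weakening and contraction; thinning $\mathcal R,\Gamma\Rightarrow\Delta$ / $\mathcal R,\mathcal R',\Gamma\Rightarrow\Delta$; $\to$L: $\mathcal R,\Gamma\Rightarrow\Delta,x:A$ and $\mathcal R,\Gamma',x:B\Rightarrow\Delta'$ / $\mathcal R,\Gamma,\Gamma',x:A\to B\Rightarrow\Delta,\Delta'$; $\to$R: $\mathcal R,\Gamma,x:A\Rightarrow\Delta,x:B$ / $\mathcal R,\Gamma\Rightarrow\Delta,x:A\to B$; $\wedge$L, $\wedge$R, $\vee$L, $\vee$R as in Gentzen's LK on labelled formulas with the same label; $\Diamond$L ($y$ fresh): $\mathcal R,xRy,\Gamma,y:A\Rightarrow\Delta$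 / $\mathcal R,\Gamma,x:\Diamond A\Rightarrow\Delta$; $\Diamond$R: $\mathcal R,xRy,\Gamma\Rightarrow\Delta,y:A$ / $\mathcal R,xRy,\Gamma\Rightarrow\Delta,x:\Diamond A$; $\Box$R ($y$ fresh): $\mathcal R,xRy,\Gamma\Rightarrow\Delta,y:A$ / $\mathcal R,\Gamma\Rightarrow\Delta,x:\Box A$; $\Box$L: $\mathcal R,xRy,\Gamma,y:A\Rightarrow\Delta$ / $\mathcal R,xRy,\Gamma,x:\Box A\Rightarrow\Delta$; tr: $\mathcal R,xRy,yRz,xRz,\Gamma\Rightarrow\Delta$ / $\mathcal R,xRy,yRz,\Gamma\Rightarrow\Delta$. $\mathsf{mlabIK4}$ is $\mathsf{labK4}$ with the restriction that in every instance of $\to$R and $\Box$R the context $\Delta$ is empty. A preproof is a possibly infinite tree of rule instances whose leaves are zero-premiss rules; a trace along an infinite branch $(S_i)$ is a sequence of labels $(x_i)_{i\ge k}$ with, for each $i$, $x_i=x_{i+1}$ or $x_iRx_{i+1}$ in the relational context of $S_i$ (progress point); progressing = infinitely many progress points; an $\infty$-proof is a preproof all of whose infinite branches have a progressing trace. $\mathsf{mlabIGL}$ is the class of $\infty$-proofs of $\mathsf{mlabIK4}$; $\mathsf{mlabIGL}\vdash x:A$ means $\emptyset\Rightarrow x:A$ has one. Kripke structures $\mathcal K$: poset $(W,\le)$, nonempty monotone domains $D_w$, monotone $\mathsf{Pr}_w:\mathsf{Pr}\to\mathcal P(D_w)$, monotone relations $R_w\subseteq D_w^2$. For a $w$-environment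 $\rho:\mathrm{Var}\to D_w$: $\mathcal K,w\models^\rho x:p$ iff $\rho(x)\in\mathsf{Pr}_w(p)$; $\bot$ never; $\wedge,\vee$ pointwise; $x:A\to B$ iff for all $w'\ge w$, $\mathcal K,w'\models^\rho x:A$ implies $\mathcal K,w'\models^\rho x:B$; $x:\Box A$ iff for all $w'\ge w$, $d\in D_{w'}$ with $\rho(x)R_{w'}d$: $\mathcal K,w'\models^{\rho[y:=d]}y:A$; $x:\Diamond A$ iff some $d\in D_w$ with $\rho(x)R_wd$ has $\mathcal K,w\models^{\rho[y:=d]}y:A$. $\mathsf{PIGL}$: structures with all $R_w$ transitive and no infinite path $(w_1,d_1)\le_{D_W}(w_2,d_1)R_{D_W}(w_2,d_2)\le_{D_W}\cdots$, where $(w,d)\le_{D_W}(w',d)$ iff $w\le w'$ and $(w,d)R_{D_W}(w,d')$ iff $dR_wd'$. $\mathsf{PIGL}\models A$: $\mathcal K,w\models^\rho x:A$ for all $\mathcal K\in\mathsf{PIGL}$, $w$, $w$-environments $\rho$, variables $x$. *)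

theory Defs
  imports Main "HOL-Library.Multiset"
begin

datatype 'p form =
    Atom 'p
  | Bot
  | And "'p form" "'p form"
  | Or "'p form" "'p form"
  | Imp "'p form" "'p form"
  | Box "'p form"
  | Dia "'p form"

text \<open>Labels (variables) are natural numbers.  A labelled formula x:A is a pair (x, A).
  A sequent R, Gamma => Delta is a triple (R, Gamma, Delta) where R is a set of
  relational atoms xRy, represented as pairs (x, y).\<close>

type_synonym label = nat
type_synonym 'p lform = "label \<times> 'p form"
type_synonym 'p sequent = "(label \<times> label) set \<times> 'p lform multiset \<times> 'p lform multiset"

definition rel_of :: "'p sequent \<Rightarrow> (label \<times> label) set" where
  "rel_of S = fst S"

definition labels_of :: "'p sequent \<Rightarrow> label set" where
  "labels_of S = (case S of (R, G, D) \<Rightarrow>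
     fst ` R \<union> snd ` R \<union> fst ` set_mset G \<union> fst ` set_mset D)"

text \<open>Rule instances of mlabIK4: rule Prems Concl means Concl follows from the list of
  premisses Prems.  This is labK4 with the restriction that in ->R and BoxR the
  succedent context Delta is empty.  The propositional rules are as in Gentzen's LK:
  AndL and OrR in one-formula form, AndR and OrL context-sharing.\<close>

inductive mlabIK4_rule :: "'p sequent list \<Rightarrow> 'p sequent \<Rightarrow> bool" where
  id: "mlabIK4_rule [] (R, {#(x, Atom p)#}, {#(x, Atom p)#})"
| botL: "mlabIK4_rule [] (R, {#(x, Bot)#} + G, D)"
| cut: "mlabIK4_rule [(R, G, D + {#(x, A)#}), (R, G' + {#(x, A)#}, D')] (R, G + G', D + D')"
| wL: "mlabIK4_rule [(R, G, D)] (R, G + {#a#}, D)"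
| wR: "mlabIK4_rule [(R, G, D)] (R, G, D + {#a#})"
| cL: "mlabIK4_rule [(R, G + {#a, a#}, D)] (R, G + {#a#}, D)"
| cR: "mlabIK4_rule [(R, G, D + {#a, a#})] (R, G, D + {#a#})"
| thin: "mlabIK4_rule [(R, G, D)] (R \<union> R', G, D)"
| impL: "mlabIK4_rule [(R, G, D + {#(x, A)#}), (R, G' + {#(x, B)#}, D')]
           (R, G + G' + {#(x, Imp A B)#}, D + D')"
| impR: "mlabIK4_rule [(R, G + {#(x, A)#}, {#(x, B)#})] (R, G, {#(x, Imp A B)#})"
| andL1: "mlabIK4_rule [(R, G + {#(x, A)#}, D)] (R, G + {#(x, And A B)#}, D)"
| andL2: "mlabIK4_rule [(R, G + {#(x, B)#}, D)] (R, G + {#(x, And A B)#}, D)"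
| andR: "mlabIK4_rule [(R, G, D + {#(x, A)#}), (R, G, D + {#(x, B)#})] (R, G, D + {#(x, And A B)#})"
| orL: "mlabIK4_rule [(R, G + {#(x, A)#}, D), (R, G + {#(x, B)#}, D)] (R, G + {#(x, Or A B)#}, D)"
| orR1: "mlabIK4_rule [(R, G, D + {#(x, A)#})] (R, G, D + {#(x, Or A B)#})"
| orR2: "mlabIK4_rule [(R, G, D + {#(x, B)#})] (R, G, D + {#(x, Or A B)#})"
| diaL: "y \<notin> labels_of (R, G + {#(x, Dia A)#}, D) \<Longrightarrow>
         mlabIK4_rule [(R \<union> {(x, y)}, G + {#(y, A)#}, D)] (R, G + {#(x, Dia A)#}, D)"
| diaR: "(x, y) \<in> R \<Longrightarrow>
         mlabIK4_rule [(R, G, D + {#(y, A)#})] (R, G, D + {#(x, Dia A)#})"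
| boxR: "y \<notin> labels_of (R, G, {#(x, Box A)#}) \<Longrightarrow>
         mlabIK4_rule [(R \<union> {(x, y)}, G, {#(y, A)#})] (R, G, {#(x, Box A)#})"
| boxL: "(x, y) \<in> R \<Longrightarrow>
         mlabIK4_rule [(R, G + {#(y, A)#}, D)] (R, G + {#(x, Box A)#}, D)"
| tr: "(x, y) \<in> R \<Longrightarrow> (y, z) \<in> R \<Longrightarrow>
         mlabIK4_rule [(R \<union> {(x, z)}, G, D)] (R, G, D)"

text \<open>A (possibly infinite) tree is given by a set T of node addresses (lists of child
  indices) and a labelling S of nodes by sequents.  It is a preproof if the root is in T
  and at each node the children are exactly the indices 0..<k for some k such that the
  children's sequents (in order) and the node's sequent form a rule instance.  Leaves
  are thus exactly instances of zero-premiss rules.  Relational contexts are finite.\<close>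

definition preproof :: "nat list set \<Rightarrow> (nat list \<Rightarrow> 'p sequent) \<Rightarrow> bool" where
  "preproof T S \<longleftrightarrow> [] \<in> T \<and>
     (\<forall>n\<in>T. finite (rel_of (S n)) \<and>
        (\<exists>k. (\<forall>i. n @ [i] \<in> T \<longleftrightarrow> i < k) \<and>
             mlabIK4_rule (map (\<lambda>i. S (n @ [i])) [0..<k]) (S n)))"

definition is_branch :: "nat list set \<Rightarrow> (nat \<Rightarrow> nat) \<Rightarrow> bool" where
  "is_branch T b \<longleftrightarrow> (\<forall>i. map b [0..<i] \<in> T)"

definition branch_seq :: "(nat list \<Rightarrow> 'p sequent) \<Rightarrow> (nat \<Rightarrow> nat) \<Rightarrow> nat \<Rightarrow> 'p sequent" where
  "branch_seq S b i = S (map b [0..<i])"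

definition is_trace :: "(nat \<Rightarrow> 'p sequent) \<Rightarrow> nat \<Rightarrow> (nat \<Rightarrow> label) \<Rightarrow> bool" where
  "is_trace Seq k t \<longleftrightarrow>
     (\<forall>i\<ge>k. t i = t (Suc i) \<or> (t i, t (Suc i)) \<in> rel_of (Seq i))"

definition progressing :: "(nat \<Rightarrow> 'p sequent) \<Rightarrow> nat \<Rightarrow> (nat \<Rightarrow> label) \<Rightarrow> bool" where
  "progressing Seq k t \<longleftrightarrow> infinite {i. k \<le> i \<and> (t i, t (Suc i)) \<in> rel_of (Seq i)}"

definition inf_proof :: "nat list set \<Rightarrow> (nat list \<Rightarrow> 'p sequent) \<Rightarrow> bool" where
  "inf_proof T S \<longleftrightarrow> preproof T S \<and>
     (\<forall>b. is_branch T b \<longrightarrow>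
        (\<exists>k t. is_trace (branch_seq S b) k t \<and> progressing (branch_seq S b) k t))"

definition mlabIGL_proves :: "label \<Rightarrow> 'p form \<Rightarrow> bool" where
  "mlabIGL_proves x A \<longleftrightarrow>
     (\<exists>T S. inf_proof T S \<and> S [] = ({}, {#}, {#(x, A)#}))"

record ('w, 'd, 'p) kstruct =
  W :: "'w set"
  le :: "'w \<Rightarrow> 'w \<Rightarrow> bool"
  D :: "'w \<Rightarrow> 'd set"
  Pr :: "'w \<Rightarrow> 'p \<Rightarrow> 'd set"
  Rl :: "'w \<Rightarrow> ('d \<times> 'd) set"

definition kripke :: "('w, 'd, 'p) kstruct \<Rightarrow> bool" where
  "kripke K \<longleftrightarrow>
     (\<forall>w\<in>W K. le K w w) \<and>
     (\<forall>u\<in>W K. \<forall>v\<in>W K. \<forall>w\<in>W K. le K u v \<longrightarrow> le K v w \<longrightarrow> le K u w) \<and>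
     (\<forall>u\<in>W K. \<forall>v\<in>W K. le K u v \<longrightarrow> le K v u \<longrightarrow> u = v) \<and>
     (\<forall>w\<in>W K. D K w \<noteq> {}) \<and>
     (\<forall>w\<in>W K. \<forall>p. Pr K w p \<subseteq> D K w) \<and>
     (\<forall>w\<in>W K. Rl K w \<subseteq> D K w \<times> D K w) \<and>
     (\<forall>u\<in>W K. \<forall>v\<in>W K. le K u v \<longrightarrow>
        D K u \<subseteq> D K v \<and> (\<forall>p. Pr K u p \<subseteq> Pr K v p) \<and> Rl K u \<subseteq> Rl K v)"

definition PIGL_struct :: "('w, 'd, 'p) kstruct \<Rightarrow> bool" where
  "PIGL_struct K \<longleftrightarrow> kripke K \<and>
     (\<forall>w\<in>W K. trans (Rl K w)) \<and>
     \<not> (\<exists>ws ds. (\<forall>i. ws i \<in> W K \<and> ds i \<in> D K (ws i)) \<and>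
               (\<forall>i. le K (ws i) (ws (Suc i)) \<and> ds i \<in> D K (ws (Suc i)) \<and>
                    (ds i, ds (Suc i)) \<in> Rl K (ws (Suc i))))"

text \<open>Forcing of a (label-free) formula at an individual d in world w.  The labelled
  satisfaction relation K,w |=^rho x:A is then forcing at rho x; the clauses for Box and
  Dia (with rho[y:=d] and y:A) amount to forcing A at d.\<close>

fun forces :: "('w, 'd, 'p) kstruct \<Rightarrow> 'w \<Rightarrow> 'd \<Rightarrow> 'p form \<Rightarrow> bool" where
  "forces K w d (Atom p) \<longleftrightarrow> d \<in> Pr K w p"
| "forces K w d Bot \<longleftrightarrow> False"
| "forces K w d (And A B) \<longleftrightarrow> forces K w d A \<and> forces K w d B"
| "forces K w d (Or A B) \<longleftrightarrow> forces K w d A \<or> forces K w d B"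
| "forces K w d (Imp A B) \<longleftrightarrow>
     (\<forall>w'\<in>W K. le K w w' \<longrightarrow> forces K w' d A \<longrightarrow> forces K w' d B)"
| "forces K w d (Box A) \<longleftrightarrow>
     (\<forall>w'\<in>W K. le K w w' \<longrightarrow> (\<forall>e\<in>D K w'. (d, e) \<in> Rl K w' \<longrightarrow> forces K w' e A))"
| "forces K w d (Dia A) \<longleftrightarrow> (\<exists>e\<in>D K w. (d, e) \<in> Rl K w \<and> forces K w e A)"

definition lsat :: "('w, 'd, 'p) kstruct \<Rightarrow> 'w \<Rightarrow> (label \<Rightarrow> 'd) \<Rightarrow> label \<Rightarrow> 'p form \<Rightarrow> bool" where
  "lsat K w \<rho> x A \<longleftrightarrow> forces K w (\<rho> x) A"

definition environment :: "('w, 'd, 'p) kstruct \<Rightarrow> 'w \<Rightarrow> (label \<Rightarrow> 'd) \<Rightarrow> bool" where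
  "environment K w \<rho> \<longleftrightarrow> (\<forall>v. \<rho> v \<in> D K w)"

definition PIGL_valid :: "'p form \<Rightarrow> bool" where
  "PIGL_valid A \<longleftrightarrow>
     (\<forall>K :: (nat, nat, 'p) kstruct. PIGL_struct K \<longrightarrow>
        (\<forall>w\<in>W K. \<forall>\<rho>. environment K w \<rho> \<longrightarrow> (\<forall>x. lsat K w \<rho> x A)))"

end

theory Submission
  imports Defs "HOL-Library.Countable_Set"
begin

text \<open>Determinacy of the proof search game is avoided as follows.  By Loeb's rule a counterexample \<open>y\<close>
  to \<open>x : \<box>B\<close> may be assumed to satisfy \<open>y : \<box>B\<close>, so labels created for boxes occur boundedly often
  on every path of a tree of labels, and an infinite path has a tail of labels created for diamonds.
  Since a label has only finitely many children created for diamonds, an infinite path exists iff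
  for some label \<open>n\<close> the component of \<open>n\<close>, the set of labels reached from \<open>n\<close> through
  diamond labels, grows forever; this condition on plays is a countable union of Buechi conditions.
  For such conditions Davis' argument for \<open>\<Sigma>\<^sup>0\<^sub>3\<close> games works with plain unprovability: ``the opponent
  avoids a set \<open>F\<close> of positions'' is read as ``not provable from the sequents in \<open>F\<close>''.  Given \<open>F\<close>, every
  unprovable position has an ordinal rank for \<open>n\<close> that decreases whenever the component of \<open>n\<close> grows.
  Ordering unprovable positions by extension together with the lexicographic descent of these
  ranks, where only finitely many \<open>n\<close> are looked at in each position, gives the countermodel.\<close>

section \<open>Proofs with open leaves\<close>

text \<open>Unprovability can replace strategies because provability composes along infinitely many
  stages: if every infinite chain of derivations plugged into each other carries a progressing
  trace, the whole is a proof. The obstacle is that a proof may have infinitely many open leaves, so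
  unprovability from \<open>forb n p\<close> for each \<open>n\<close> need not give unprovability
  from the union over all \<open>n\<close>. For this reason a step of the order controls only
  finitely many components, and the bound increases with the number of labels, so that each
  component is controlled from some point on along the chains that have to be excluded. Cut makes
  positions complete, so truth in the model is membership in the antecedent. Only implications and
  boxes lose the succedent and lead to a later world; witnesses for diamonds are added while all
  truth values at old labels are kept. Positions are finite objects, which yields a model over the
  natural numbers as \<open>PIGL_valid\<close> demands.\<close>

definition good :: "(nat \<Rightarrow> 'p sequent) \<Rightarrow> bool" where
  "good f \<longleftrightarrow> (\<exists>x t. strict_mono t \<and> (\<forall>k::nat. (x k, x (Suc k)) \<in> rel_of (f (t k))))"

text \<open>A trace may wait at a label, so edges used at increasing times \<open>t k\<close> become
  a trace by waiting in between. \<open>good\<close> records only the progress points, which makes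
  it easy to pass to subsequences and suffixes.\<close>

lemma good_imp_progressing:
  assumes "good f"
  shows "\<exists>k t. is_trace f k t \<and> progressing f k t"
proof -
  obtain x t where t: "strict_mono t" and x: "\<And>k::nat. (x k, x (Suc k)) \<in> rel_of (f (t k))"
    using assms unfolding good_def by blast
  \<comment> \<open>\<open>N i\<close> counts the moves made before time \<open>i\<close>; the trace
    is then at \<open>x (N i)\<close>.\<close>
  define N where "N i = card {k. t k < i}" for i
  have fin: "finite {k. t k < i}" for i
    by (rule finite_subset[of _ "{..<i}"])
      (use strict_mono_imp_increasing[OF t] in \<open>auto intro: le_less_trans\<close>)
  have N1: "N (t k) = k" for k
    unfolding N_def using t by (simp add: strict_mono_less)
  have N2: "N (Suc (t k)) = Suc k" for k
  proof -
    have "{j. t j < Suc (t k)} = {..k}"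
      using t by (auto simp: less_Suc_eq_le strict_mono_less_eq)
    then show ?thesis by (simp add: N_def)
  qed
  have N3: "N (Suc i) = N i" if "i \<notin> range t" for i
  proof -
    have "{j. t j < Suc i} = {j. t j < i}"
      using that by (auto simp: less_Suc_eq)
    then show ?thesis by (simp add: N_def)
  qed
  have step: "(x (N i), x (N (Suc i))) \<in> rel_of (f i)" if "i \<in> range t" for i
    using that x by (auto simp: N1 N2)
  have "is_trace f 0 (\<lambda>i. x (N i))"
    unfolding is_trace_def using step N3 by metis
  moreover have "infinite (range t)"
    using t by (simp add: finite_image_iff strict_mono_imp_inj_on)
  then have "progressing f 0 (\<lambda>i. x (N i))"
    unfolding progressing_def using step
    by (elim contrapos_nn finite_subset[rotated]) auto
  ultimately show ?thesis by blast
qed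

lemma good_subseq:
  assumes "strict_mono s" "good (\<lambda>i. f (s i))"
  shows "good f"
proof -
  obtain x t where t: "strict_mono t" and x: "\<And>k::nat. (x k, x (Suc k)) \<in> rel_of (f (s (t k)))"
    using assms(2) unfolding good_def by blast
  have "strict_mono (\<lambda>k. s (t k))"
    using assms(1) t by (simp add: strict_mono_def)
  with x show ?thesis unfolding good_def by (intro exI[of _ x] exI[of _ "\<lambda>k. s (t k)"]) simp
qed

text \<open>Strict monotonicity gives \<open>m \<le> t (k + m)\<close>, so after dropping the first
  \<open>m\<close> edges all remaining ones are used at time \<open>m\<close> or later.\<close>

lemma good_suffix:
  assumes "good f"
  shows "good (\<lambda>i. f (i + m))"
proof -
  obtain x t where t: "strict_mono t" and x: "\<And>k::nat. (x k, x (Suc k)) \<in> rel_of (f (t k))"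
    using assms unfolding good_def by blast
  have ge: "m + k \<le> t (m + k)" for k
    using strict_mono_imp_increasing[OF t] .
  have ge': "m \<le> t (k + m)" for k
    using ge[of k] by (simp add: add.commute)
  have "strict_mono (\<lambda>k. t (k + m) - m)"
    unfolding strict_mono_def using t ge'
    by (metis add_less_cancel_right diff_less_mono strict_monoD)
  moreover have "(x (k + m), x (Suc k + m)) \<in> rel_of (f (t (k + m) - m + m))" for k
    using x[of "k + m"] ge'[of k] by simp
  ultimately show ?thesis
    unfolding good_def by (intro exI[of _ "\<lambda>k. x (k + m)"] exI[of _ "\<lambda>k. t (k + m) - m"]) simp
qed

definition pproof :: "'p sequent set \<Rightarrow> nat list set \<Rightarrow> (nat list \<Rightarrow> 'p sequent) \<Rightarrow> bool" where
  "pproof H T S \<longleftrightarrow> [] \<in> T \<and>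
     (\<forall>n\<in>T. finite (rel_of (S n)) \<and>
        (\<exists>k. (\<forall>i. n @ [i] \<in> T \<longleftrightarrow> i < k) \<and>
             (mlabIK4_rule (map (\<lambda>i. S (n @ [i])) [0..<k]) (S n) \<or> k = 0 \<and> S n \<in> H))) \<and>
     (\<forall>b. is_branch T b \<longrightarrow> good (branch_seq S b))"

definition pprov :: "'p sequent set \<Rightarrow> 'p sequent \<Rightarrow> bool" where
  "pprov H s \<longleftrightarrow> (\<exists>T S. pproof H T S \<and> S [] = s)"

lemma pprov_empty_imp_proves:
  assumes "pprov {} ({}, {#}, {#(x, A)#})"
  shows "mlabIGL_proves x A"
proof -
  obtain T S where T: "pproof {} T S" and S: "S [] = ({}, {#}, {#(x, A)#})"
    using assms unfolding pprov_def by blast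
  have "preproof T S"
    using T unfolding pproof_def preproof_def by simp
  moreover have "\<exists>k t. is_trace (branch_seq S b) k t \<and> progressing (branch_seq S b) k t"
    if "is_branch T b" for b
    using T that good_imp_progressing unfolding pproof_def by blast
  ultimately show ?thesis
    unfolding mlabIGL_proves_def inf_proof_def using S by blast
qed

lemma pprov_mono:
  assumes "pprov H s" "H \<subseteq> H'"
  shows "pprov H' s"
proof -
  have "pproof H T S \<Longrightarrow> pproof H' T S" for T S
    unfolding pproof_def using assms(2) by blast
  then show ?thesis using assms(1) unfolding pprov_def by blast
qed

lemma pprov_finite: "pprov H s \<Longrightarrow> finite (rel_of s)"
  unfolding pprov_def pproof_def by auto

section \<open>Unravelling of graphs and infinite composition of proofs\<close>

primrec valid_addr :: "('q \<Rightarrow> 'q list) \<Rightarrow> 'q \<Rightarrow> nat list \<Rightarrow> bool" where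
  "valid_addr ch q [] \<longleftrightarrow> True"
| "valid_addr ch q (i # n) \<longleftrightarrow> i < length (ch q) \<and> valid_addr ch (ch q ! i) n"

abbreviation walk :: "('q \<Rightarrow> 'q list) \<Rightarrow> 'q \<Rightarrow> nat list \<Rightarrow> 'q" where
  "walk ch \<equiv> foldl (\<lambda>q i. ch q ! i)"

lemma valid_addr_snoc:
  "valid_addr ch q (n @ [i]) \<longleftrightarrow> valid_addr ch q n \<and> i < length (ch (walk ch q n))"
  by (induction n arbitrary: q) auto

text \<open>Unravelling from \<open>q0\<close> turns the graph into a tree whose branches are paths
  of the graph. Proofs can thus be given by local conditions, without addresses.\<close>

lemma pprov_graph:
  fixes q0 :: 'q
  assumes q0: "q0 \<in> Q"
    and node: "\<And>q. q \<in> Q \<Longrightarrow> finite (rel_of (sq q)) \<and> set (ch q) \<subseteq> Q \<and>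
      (mlabIK4_rule (map sq (ch q)) (sq q) \<or> ch q = [] \<and> sq q \<in> H)"
    and paths: "\<And>f. (\<And>i. f i \<in> Q \<and> f (Suc i) \<in> set (ch (f i))) \<Longrightarrow> good (\<lambda>i. sq (f i))"
  shows "pprov H (sq q0)"
proof -
  define T where "T = Collect (valid_addr ch q0)"
  define S where "S n = sq (walk ch q0 n)" for n
  have inQ: "walk ch q0 n \<in> Q" if "valid_addr ch q0 n" for n
    using that
  proof (induction n rule: rev_induct)
    case Nil
    then show ?case using q0 by simp
  next
    case (snoc i n)
    then have "walk ch q0 n \<in> Q" "i < length (ch (walk ch q0 n))"
      by (auto simp: valid_addr_snoc)
    then show ?case using node[of "walk ch q0 n"] by auto
  qed
  have "finite (rel_of (S n)) \<and>
        (\<exists>k. (\<forall>i. n @ [i] \<in> T \<longleftrightarrow> i < k) \<and>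
             (mlabIK4_rule (map (\<lambda>i. S (n @ [i])) [0..<k]) (S n) \<or> k = 0 \<and> S n \<in> H))"
    if "n \<in> T" for n
  proof -
    let ?q = "walk ch q0 n"
    have v: "valid_addr ch q0 n" using that by (simp add: T_def)
    have "map (\<lambda>i. S (n @ [i])) [0..<length (ch ?q)] = map sq (ch ?q)"
      by (rule nth_equalityI) (auto simp: S_def)
    then show ?thesis
      using node[OF inQ[OF v]] v
      by (intro conjI exI[of _ "length (ch ?q)"]) (auto simp: T_def S_def valid_addr_snoc)
  qed
  moreover have "good (branch_seq S b)" if b: "is_branch T b" for b
  proof -
    let ?f = "\<lambda>i. walk ch q0 (map b [0..<i])"
    have v: "valid_addr ch q0 (map b [0..<i])" for i
      using b by (auto simp: is_branch_def T_def)
    have "?f i \<in> Q \<and> ?f (Suc i) \<in> set (ch (?f i))" for i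
      using inQ[OF v] v[of "Suc i"] by (auto simp: valid_addr_snoc)
    then have "good (\<lambda>i. sq (?f i))" by (rule paths)
    then show ?thesis by (simp add: branch_seq_def[abs_def] S_def)
  qed
  ultimately have "pproof H T S"
    unfolding pproof_def by (auto simp: T_def)
  moreover have "S [] = sq q0" by (simp add: S_def)
  ultimately show ?thesis unfolding pprov_def by blast
qed

text \<open>Each \<open>s\<close> has a derivation whose open leaves outside \<open>H\<close> are
  sequents of \<open>N s\<close>. When these derivations are plugged into each other, a branch
  either changes derivation infinitely often and contains a macro path, or stays in one derivation
  from some point on. Loeb's rule and the existence of ranks both rest on this principle.\<close>

lemma pprov_macro:
  fixes sq :: "'s \<Rightarrow> 'p sequent"
  assumes step: "\<And>s. s \<in> X \<Longrightarrow> N s \<subseteq> X \<and> pprov (H \<union> sq ` N s) (sq s)"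
    and paths: "\<And>f. (\<And>i::nat. f i \<in> X \<and> f (Suc i) \<in> N (f i)) \<Longrightarrow> good (\<lambda>i. sq (f i))"
    and s0: "s0 \<in> X"
  shows "pprov H (sq s0)"
proof -
  have "\<forall>s\<in>X. \<exists>TS. pproof (H \<union> sq ` N s) (fst TS) (snd TS) \<and> snd TS [] = sq s"
    using step unfolding pprov_def by (metis fst_conv snd_conv)
  then obtain TS where TS: "\<And>s. s \<in> X \<Longrightarrow>
      pproof (H \<union> sq ` N s) (fst (TS s)) (snd (TS s)) \<and> snd (TS s) [] = sq s"
    by metis
  define T where "T s = fst (TS s)" for s
  define S where "S s = snd (TS s)" for s
  have root: "[] \<in> T s" "S s [] = sq s"
    and fin: "n \<in> T s \<Longrightarrow> finite (rel_of (S s n))"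
    and node: "n \<in> T s \<Longrightarrow> (\<exists>k. (\<forall>i. n @ [i] \<in> T s \<longleftrightarrow> i < k) \<and>
             (mlabIK4_rule (map (\<lambda>i. S s (n @ [i])) [0..<k]) (S s n) \<or>
              k = 0 \<and> S s n \<in> H \<union> sq ` N s))"
    and br: "is_branch (T s) b \<Longrightarrow> good (branch_seq (S s) b)"
    if "s \<in> X" for s n b
    using TS[OF that] unfolding pproof_def T_def S_def by blast+
  \<comment> \<open>Closure of \<open>T s\<close> under prefixes is not part of
    \<open>pproof\<close>, but the branch condition speaks of all prefixes, so they are recorded
    here.\<close>
  define Q where "Q = {(s, n). s \<in> X \<and> (\<forall>i\<le>length n. take i n \<in> T s)}"
  define sqq where "sqq = (\<lambda>(s, n). S s n)"
  define ruled where "ruled s n k \<longleftrightarrow> (\<forall>i. n @ [i] \<in> T s \<longleftrightarrow> i < k) \<and>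
      mlabIK4_rule (map (\<lambda>i. S s (n @ [i])) [0..<k]) (S s n)" for s n k
  define ch where "ch = (\<lambda>(s, n). if \<exists>k. ruled s n k
      then map (\<lambda>i. (s, n @ [i])) [0..<(SOME k. ruled s n k)]
      else if S s n \<in> H then [] else [(SOME s'. s' \<in> N s \<and> sq s' = S s n, [])])"
  have nodeQ: "finite (rel_of (sqq q)) \<and> set (ch q) \<subseteq> Q \<and>
      (mlabIK4_rule (map sqq (ch q)) (sqq q) \<or> ch q = [] \<and> sqq q \<in> H) \<and>
      (\<forall>q'\<in>set (ch q). fst q' = fst q \<and> (\<exists>i. snd q' = snd q @ [i]) \<or>
         fst q' \<in> N (fst q) \<and> snd q' = [])"
    if "q \<in> Q" for q
  proof -
    obtain s n where q: "q = (s, n)" by force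
    have s: "s \<in> X" and tk: "\<And>i. i \<le> length n \<Longrightarrow> take i n \<in> T s"
      using that by (auto simp: q Q_def)
    have n: "n \<in> T s" using tk[of "length n"] by simp
    have f: "finite (rel_of (sqq q))" using fin[OF s n] by (simp add: sqq_def q)
    show ?thesis
    proof (cases "\<exists>k. ruled s n k")
      case True
      define k where "k = (SOME k. ruled s n k)"
      have k: "ruled s n k" using True unfolding k_def by (rule someI_ex)
      have chq: "ch q = map (\<lambda>i. (s, n @ [i])) [0..<k]"
        using True by (simp add: ch_def q k_def)
      have "map sqq (ch q) = map (\<lambda>i. S s (n @ [i])) [0..<k]"
        by (simp add: chq sqq_def)
      then have "mlabIK4_rule (map sqq (ch q)) (sqq q)"
        using k by (simp add: ruled_def sqq_def q)
      moreover have "(s, n @ [i]) \<in> Q" if "i < k" for i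
      proof -
        have "n @ [i] \<in> T s" using k that by (simp add: ruled_def)
        then have "take j (n @ [i]) \<in> T s" if "j \<le> Suc (length n)" for j
          using tk[of j] that by (cases "j \<le> length n") auto
        then show ?thesis using s by (simp add: Q_def)
      qed
      then have "set (ch q) \<subseteq> Q" by (auto simp: chq)
      moreover have "\<forall>q'\<in>set (ch q). fst q' = fst q \<and> (\<exists>i. snd q' = snd q @ [i])"
        unfolding chq by (simp add: q)
      ultimately show ?thesis using f by blast
    next
      case False
      then have mem: "S s n \<in> H \<union> sq ` N s"
        using node[OF s n] unfolding ruled_def by blast
      show ?thesis
      proof (cases "S s n \<in> H")
        case True
        then have "ch q = []" unfolding ch_def q prod.case if_not_P[OF False] by simp
        then show ?thesis using True f by (simp add: q sqq_def)
      next
        case False2: False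
        define s' where "s' = (SOME s'. s' \<in> N s \<and> sq s' = S s n)"
        have s': "s' \<in> N s \<and> sq s' = S s n"
          unfolding s'_def by (rule someI_ex) (use mem False2 in auto)
        have X': "s' \<in> X" using step[OF s] s' by blast
        have chq: "ch q = [(s', [])]"
          unfolding ch_def q prod.case if_not_P[OF False] if_not_P[OF False2] s'_def ..
        obtain R G D where e: "S s n = (R, G, D)" by (cases "S s n")
        \<comment> \<open>A jump to the next derivation has to be a rule instance: thinning by the
          empty set has equal premiss and conclusion.\<close>
        have "mlabIK4_rule [S s n] (S s n)"
          using mlabIK4_rule.thin[of R G D "{}"] by (simp add: e)
        moreover have "sqq (s', []) = S s n" using root[OF X'] s' by (simp add: sqq_def)
        moreover have "(s', []) \<in> Q" using X' root by (simp add: Q_def)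
        ultimately show ?thesis using f s' by (simp add: chq) (simp add: sqq_def q)
      qed
    qed
  qed
  have "pprov H (sqq (s0, []))"
  proof (rule pprov_graph[where Q = Q and ch = ch])
    show "(s0, []) \<in> Q" using s0 root by (simp add: Q_def)
    show "finite (rel_of (sqq q)) \<and> set (ch q) \<subseteq> Q \<and>
      (mlabIK4_rule (map sqq (ch q)) (sqq q) \<or> ch q = [] \<and> sqq q \<in> H)" if "q \<in> Q" for q
      using nodeQ[OF that] by blast
    fix f assume f: "\<And>i. f i \<in> Q \<and> f (Suc i) \<in> set (ch (f i))"
    have st: "fst (f (Suc i)) = fst (f i) \<and> (\<exists>c. snd (f (Suc i)) = snd (f i) @ [c]) \<or>
         fst (f (Suc i)) \<in> N (fst (f i)) \<and> snd (f (Suc i)) = []" for i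
      using nodeQ[of "f i"] f[of i] by blast
    have fX: "fst (f i) \<in> X" for i using f[of i] by (auto simp: Q_def)
    \<comment> \<open>These are the jumps: inside a derivation the address only gets longer, so it
      is empty after a step exactly if the step was a jump.\<close>
    define J where "J = {i. snd (f (Suc i)) = []}"
    have noJ: "fst (f (Suc i)) = fst (f i)" "\<exists>c. snd (f (Suc i)) = snd (f i) @ [c]"
      if "i \<notin> J" for i
      using st[of i] that by (auto simp: J_def)
    have inJ: "fst (f (Suc i)) \<in> N (fst (f i))" if "i \<in> J" for i
      using st[of i] that by (auto simp: J_def)
    show "good (\<lambda>i. sqq (f i))"
    proof (cases "finite J")
      case False
      define e where "e = enumerate J"
      have e: "strict_mono e" "\<And>j. e j \<in> J"
        using False by (auto simp: e_def strict_mono_enumerate enumerate_in_set)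
      have gap: "i \<notin> J" if "e j < i" "i < e (Suc j)" for i j
        using that not_less_Least[of i "\<lambda>s. s \<in> J \<and> e j < s"] False
        by (auto simp: e_def enumerate_Suc'')
      have const: "fst (f (Suc (e j) + d)) = fst (f (Suc (e j)))" if "Suc (e j) + d \<le> e (Suc j)" for j d
        using that
      proof (induction d)
        case (Suc d)
        then have "Suc (e j) + d \<notin> J" by (intro gap[of j]) auto
        then show ?case using Suc noJ by simp
      qed simp
      define g where "g j = fst (f (Suc (e j)))" for j
      have e_lt: "e j < e (Suc j)" for j
        using e(1) by (simp add: strict_mono_Suc_iff)
      have "Suc (e j) + (e (Suc j) - Suc (e j)) = e (Suc j)" for j
        using e_lt[of j] by linarith
      then have "g (Suc j) \<in> N (g j)" for j
        using inJ[OF e(2)[of "Suc j"]] const[of j "e (Suc j) - Suc (e j)"] by (simp add: g_def)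
      then have "good (\<lambda>j. sq (g j))"
        using fX by (intro paths) (simp add: g_def)
      moreover have "sqq (f (Suc (e j))) = sq (g j)" for j
        using e(2)[of j] root(2)[OF fX[of "Suc (e j)"]]
        by (simp add: sqq_def g_def J_def split_beta)
      ultimately have "good (\<lambda>j. sqq (f (Suc (e j))))" by simp
      moreover have "strict_mono (\<lambda>j. Suc (e j))" using e(1) by (simp add: strict_mono_def)
      ultimately show ?thesis by (rule good_subseq[rotated])
    next
      case True
      then obtain M where M: "\<And>i. i \<ge> M \<Longrightarrow> i \<notin> J"
        unfolding finite_nat_set_iff_bounded by (meson not_less)
      define s where "s = fst (f M)"
      define n0 where "n0 = snd (f M)"
      define c where "c j = last (snd (f (M + Suc j)))" for j
      have fM: "f (M + j) = (s, n0 @ map c [0..<j])" for j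
      proof (induction j)
        case 0
        then show ?case by (simp add: s_def n0_def)
      next
        case (Suc j)
        have nj: "M + j \<notin> J" using M by simp
        obtain d where d: "snd (f (M + Suc j)) = snd (f (M + j)) @ [d]"
          using noJ(2)[OF nj] by auto
        then have "c j = d" by (simp add: c_def)
        then have "snd (f (M + Suc j)) = n0 @ map c [0..<Suc j]" using d Suc by simp
        moreover have "fst (f (M + Suc j)) = s" using noJ(1)[OF nj] Suc by simp
        ultimately show ?case by (simp add: prod_eq_iff)
      qed
      have sX: "s \<in> X" using fX by (simp add: s_def)
      \<comment> \<open>The tail of the path starts at address \<open>n0\<close>; putting
        \<open>n0\<close> in front makes it a branch from the root, of which the tail is a
        suffix.\<close>
      define b where "b i = (if i < length n0 then n0 ! i else c (i - length n0))" for i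
      have b1: "map b [0..<i + length n0] = n0 @ map c [0..<i]" for i
        by (rule nth_equalityI) (auto simp: b_def nth_append)
      have b2: "map b [0..<i] = take i n0" if "i \<le> length n0" for i
        using that by (intro nth_equalityI) (auto simp: b_def)
      have "map b [0..<i] \<in> T s" for i
      proof (cases "i \<le> length n0")
        case True
        then show ?thesis using b2[OF True] f[of M] by (simp add: Q_def s_def n0_def split_beta)
      next
        case False
        define j where "j = i - length n0"
        have j: "i = j + length n0" using False by (simp add: j_def)
        have "snd (f (M + j)) \<in> T (fst (f (M + j)))"
          using f[of "M + j"] by (auto simp: Q_def split_beta)
        then show ?thesis by (simp add: j b1 fM)
      qed
      then have "good (branch_seq (S s) b)" using br[OF sX] by (simp add: is_branch_def)
      then have "good (\<lambda>i. branch_seq (S s) b (i + length n0))" by (rule good_suffix)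
      moreover have "branch_seq (S s) b (i + length n0) = sqq (f (M + i))" for i
        by (simp add: branch_seq_def b1 fM sqq_def)
      ultimately have "good (\<lambda>i. sqq (f (M + i)))" by simp
      then show ?thesis
        by (rule good_subseq[rotated]) (simp add: strict_mono_def)
    qed
  qed
  then show ?thesis using root[OF s0] by (simp add: sqq_def)
qed

lemma pprov_hyp:
  assumes "s \<in> H" "finite (rel_of s)"
  shows "pprov H s"
  by (rule pprov_graph[where Q = UNIV and sq = "\<lambda>_. s" and ch = "\<lambda>_. []" and ?q0.0 = "()"])
    (use assms in simp_all)

lemma pprov_trans:
  assumes s: "pprov (H \<union> K) s" and K: "\<And>k. k \<in> K \<Longrightarrow> pprov H k"
  shows "pprov H s"
proof -
  define sq where "sq = case_option s id"
  define N where "N = case_option (Some ` K) (\<lambda>_::'a sequent. {})"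
  have "pprov H (sq None)"
  proof (rule pprov_macro[where X = "insert None (Some ` K)" and N = N])
    show "N q \<subseteq> insert None (Some ` K) \<and> pprov (H \<union> sq ` N q) (sq q)"
      if "q \<in> insert None (Some ` K)" for q
      using that s K by (auto simp: N_def sq_def image_image)
    fix f :: "nat \<Rightarrow> 'a sequent option"
    assume f: "\<And>i. f i \<in> insert None (Some ` K) \<and> f (Suc i) \<in> N (f i)"
    have "N (f 1) = {}" using f[of 0] by (auto simp: N_def split: option.splits)
    then show "good (\<lambda>i. sq (f i))" using f[of 1] by simp
  qed simp
  then show ?thesis by (simp add: sq_def)
qed

lemma pprov_rule:
  assumes rule: "mlabIK4_rule ps c" and fin: "finite (rel_of c)"
    and ps: "\<And>p. p \<in> set ps \<Longrightarrow> pprov H p"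
  shows "pprov H c"
proof -
  define sq where "sq = case_option c id"
  define ch where "ch = case_option (map Some ps) (\<lambda>_::'a sequent. [])"
  have "pprov (H \<union> set ps) (sq None)"
  proof (rule pprov_graph[where Q = "insert None (Some ` set ps)" and ch = ch])
    show "finite (rel_of (sq q)) \<and> set (ch q) \<subseteq> insert None (Some ` set ps) \<and>
      (mlabIK4_rule (map sq (ch q)) (sq q) \<or> ch q = [] \<and> sq q \<in> H \<union> set ps)"
      if "q \<in> insert None (Some ` set ps)" for q
      using that rule fin pprov_finite[OF ps] by (auto simp: ch_def sq_def comp_def)
    fix f :: "nat \<Rightarrow> 'a sequent option"
    assume f: "\<And>i. f i \<in> insert None (Some ` set ps) \<and> f (Suc i) \<in> set (ch (f i))"
    have "ch (f 1) = []" using f[of 0] by (auto simp: ch_def split: option.splits)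
    then show "good (\<lambda>i. sq (f i))" using f[of 1] by simp
  qed simp
  then show ?thesis using ps by (auto simp: sq_def intro: pprov_trans)
qed

section \<open>Derived rules\<close>

lemma pprov_rule1:
  "mlabIK4_rule [p] c \<Longrightarrow> finite (rel_of c) \<Longrightarrow> pprov H p \<Longrightarrow> pprov H c"
  by (erule pprov_rule) auto

lemma pprov_rule2:
  "mlabIK4_rule [p, q] c \<Longrightarrow> finite (rel_of c) \<Longrightarrow> pprov H p \<Longrightarrow> pprov H q \<Longrightarrow> pprov H c"
  by (erule pprov_rule) auto

lemma rel_of_simp [simp]: "rel_of (R, G, M) = R"
  by (simp add: rel_of_def)

lemma pprov_weakenL: "pprov H (R, G, M) \<Longrightarrow> pprov H (R, G + G', M)"
proof (induction G')
  case (add a G')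
  then show ?case
    using pprov_rule1[OF mlabIK4_rule.wL[of R "G + G'" M a], of H] pprov_finite[OF add.prems] by simp
qed simp

lemma pprov_weakenR: "pprov H (R, G, M) \<Longrightarrow> pprov H (R, G, M + M')"
proof (induction M')
  case (add a M')
  then show ?case
    using pprov_rule1[OF mlabIK4_rule.wR[of R G "M + M'" a], of H] pprov_finite[OF add.prems] by simp
qed simp

lemma pprov_contractL: "pprov H (R, E + G, M) \<Longrightarrow> set_mset E \<subseteq> set_mset G \<Longrightarrow> pprov H (R, G, M)"
proof (induction E)
  case (add a E)
  define X where "X = E + G - {#a#}"
  have "a \<in># E + G" using add.prems(2) by simp
  then have X: "E + G = X + {#a#}" by (simp add: X_def)
  have "pprov H (R, X + {#a, a#}, M)"
    using add.prems(1) unfolding X[symmetric] by (simp add: X)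
  then have "pprov H (R, X + {#a#}, M)"
    using pprov_finite[OF add.prems(1)] by (intro pprov_rule1[OF mlabIK4_rule.cL]) simp_all
  then show ?case using add X by simp
qed simp

lemma pprov_contractR: "pprov H (R, G, E + M) \<Longrightarrow> set_mset E \<subseteq> set_mset M \<Longrightarrow> pprov H (R, G, M)"
proof (induction E)
  case (add a E)
  define X where "X = E + M - {#a#}"
  have "a \<in># E + M" using add.prems(2) by simp
  then have X: "E + M = X + {#a#}" by (simp add: X_def)
  have "pprov H (R, G, X + {#a, a#})"
    using add.prems(1) unfolding X[symmetric] by (simp add: X)
  then have "pprov H (R, G, X + {#a#})"
    using pprov_finite[OF add.prems(1)] by (intro pprov_rule1[OF mlabIK4_rule.cR]) simp_all
  then show ?case using add X by simp
qed simp

text \<open>With weakening, contraction and thinning, only the underlying sets of the two multisets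
  matter; hence sequents of sets suffice from here on.\<close>

lemma pprov_struct:
  assumes p: "pprov H (R, G, M)" and R: "R \<subseteq> R'" "finite R'"
    and G: "set_mset G \<subseteq> set_mset G'" and M: "set_mset M \<subseteq> set_mset M'"
  shows "pprov H (R', G', M')"
proof -
  have "pprov H (R \<union> R', G, M)"
    using p R pprov_finite[OF p] by (intro pprov_rule1[OF mlabIK4_rule.thin]) auto
  then have "pprov H (R', G, M)" using R by (simp add: Un_absorb1)
  then have "pprov H (R', G + G', M + M')"
    by (rule pprov_weakenR[OF pprov_weakenL])
  then have "pprov H (R', G', M + M')"
    using G by (rule pprov_contractL)
  then show ?thesis
    using M by (rule pprov_contractR)
qed

text \<open>\<open>sseq\<close> reads a sequent built from finite sets; on infinite sets \<^const>\<open>mset_set\<close> is junk.\<close>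

definition sseq :: "(label \<times> label) set \<Rightarrow> 'p lform set \<Rightarrow> 'p lform set \<Rightarrow> 'p sequent" where
  "sseq R \<Gamma> \<Delta> = (R, mset_set \<Gamma>, mset_set \<Delta>)"

lemma rel_of_sseq [simp]: "rel_of (sseq R \<Gamma> \<Delta>) = R"
  by (simp add: sseq_def)

lemma pprov_to_sseq:
  assumes "pprov H (R, G, M)" "R \<subseteq> R'" "finite R'" "set_mset G \<subseteq> \<Gamma>" "set_mset M \<subseteq> \<Delta>"
    "finite \<Gamma>" "finite \<Delta>"
  shows "pprov H (sseq R' \<Gamma> \<Delta>)"
  unfolding sseq_def by (rule pprov_struct[OF assms(1)]) (use assms in auto)

lemma pprov_of_sseq:
  assumes "pprov H (sseq R \<Gamma> \<Delta>)" "finite \<Gamma>" "finite \<Delta>" "\<Gamma> \<subseteq> set_mset G" "\<Delta> \<subseteq> set_mset M"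
  shows "pprov H (R, G, M)"
  by (rule pprov_struct[OF assms(1)[unfolded sseq_def]]) (use assms pprov_finite[OF assms(1)] in auto)

lemma pprov_sseq_mono:
  assumes "pprov H (sseq R \<Gamma> \<Delta>)" "R \<subseteq> R'" "\<Gamma> \<subseteq> \<Gamma>'" "\<Delta> \<subseteq> \<Delta>'" "finite R'" "finite \<Gamma>'" "finite \<Delta>'"
  shows "pprov H (sseq R' \<Gamma>' \<Delta>')"
  unfolding sseq_def
  by (rule pprov_struct[OF assms(1)[unfolded sseq_def]])
    (use assms finite_subset[OF assms(3)] finite_subset[OF assms(4)] in simp_all)

lemma pprov_cut:
  assumes "pprov H (sseq R \<Gamma> (insert (x, A) \<Delta>))" "pprov H (sseq R (insert (x, A) \<Gamma>) \<Delta>)"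
    "finite \<Gamma>" "finite \<Delta>"
  shows "pprov H (sseq R \<Gamma> \<Delta>)"
proof -
  have fin: "finite R" using pprov_finite[OF assms(1)] by simp
  have "pprov H (R, mset_set \<Gamma> + mset_set \<Gamma>, mset_set \<Delta> + mset_set \<Delta>)"
    by (rule pprov_rule2[OF mlabIK4_rule.cut])
      (use assms fin in \<open>auto intro: pprov_of_sseq\<close>)
  then show ?thesis by (rule pprov_to_sseq) (use assms fin in auto)
qed

text \<open>Read upwards, everything in \<open>\<Delta>\<close> but the principal formula is
  discarded, as the empty context of the rule demands.\<close>

lemma pprov_impR:
  assumes "pprov H (sseq R (insert (x, A) \<Gamma>) {(x, B)})" "(x, Imp A B) \<in> \<Delta>" "finite \<Gamma>" "finite \<Delta>"
  shows "pprov H (sseq R \<Gamma> \<Delta>)"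
proof -
  have fin: "finite R" using pprov_finite[OF assms(1)] by simp
  have "pprov H (R, mset_set \<Gamma>, {#(x, Imp A B)#})"
    by (rule pprov_rule1[OF mlabIK4_rule.impR])
      (use assms fin in \<open>auto intro: pprov_of_sseq\<close>)
  then show ?thesis by (rule pprov_to_sseq) (use assms fin in auto)
qed

lemma pprov_boxR:
  assumes "pprov H (sseq (R \<union> {(x, y)}) \<Gamma> {(y, B)})" "(x, Box B) \<in> \<Delta>" "finite \<Gamma>" "finite \<Delta>"
    "y \<noteq> x" "y \<notin> Field R" "y \<notin> fst ` \<Gamma>"
  shows "pprov H (sseq R \<Gamma> \<Delta>)"
proof -
  have fin: "finite R" using pprov_finite[OF assms(1)] by simp
  have "pprov H (R, mset_set \<Gamma>, {#(x, Box B)#})"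
    by (rule pprov_rule1[OF mlabIK4_rule.boxR[of y]])
      (use assms fin in \<open>auto intro: pprov_of_sseq simp: labels_of_def Field_def Domain_fst Range_snd\<close>)
  then show ?thesis by (rule pprov_to_sseq) (use assms fin in auto)
qed

lemma pprov_diaL:
  assumes "pprov H (sseq (R \<union> {(x, y)}) (insert (y, B) \<Gamma>) \<Delta>)" "(x, Dia B) \<in> \<Gamma>" "finite \<Gamma>" "finite \<Delta>"
    "y \<notin> Field R" "y \<notin> fst ` \<Gamma>" "y \<notin> fst ` \<Delta>"
  shows "pprov H (sseq R \<Gamma> \<Delta>)"
proof -
  have fin: "finite R" using pprov_finite[OF assms(1)] by simp
  have "y \<noteq> x" using assms by force
  then have "pprov H (R, mset_set \<Gamma> + {#(x, Dia B)#}, mset_set \<Delta>)"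
    by (intro pprov_rule1[OF mlabIK4_rule.diaL[of y]])
      (use assms fin in \<open>auto intro: pprov_of_sseq simp: labels_of_def Field_def Domain_fst Range_snd\<close>)
  then show ?thesis by (rule pprov_to_sseq) (use assms fin in auto)
qed

lemma pprov_tr1:
  assumes p: "pprov H (sseq (R \<union> {(z, y)}) \<Gamma> \<Delta>)" and "(z, x) \<in> R" "(x, y) \<in> R"
  shows "pprov H (sseq R \<Gamma> \<Delta>)"
proof -
  have "finite R" using pprov_finite[OF p] by simp
  then show ?thesis
    using p unfolding sseq_def
    by (intro pprov_rule1[OF mlabIK4_rule.tr[OF assms(2,3)]]) simp_all
qed

text \<open>One edge from \<open>x\<close> to \<open>y\<close> brings along edges from all
  predecessors of \<open>x\<close>, so the relation can be kept transitive when a label is added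
  above \<open>x\<close>.\<close>

lemma pprov_tr:
  assumes "finite P" "(x, y) \<in> R"
  shows "pprov H (sseq (R \<union> P \<times> {y}) \<Gamma> \<Delta>) \<Longrightarrow> (\<And>z. z \<in> P \<Longrightarrow> z = x \<or> (z, x) \<in> R) \<Longrightarrow>
    pprov H (sseq R \<Gamma> \<Delta>)"
  using assms(1)
proof (induction P)
  case empty
  then show ?case by simp
next
  case (insert z P)
  have eq: "R \<union> insert z P \<times> {y} = R \<union> P \<times> {y} \<union> {(z, y)}" by blast
  have p: "pprov H (sseq (R \<union> P \<times> {y} \<union> {(z, y)}) \<Gamma> \<Delta>)"
    using insert.prems(1) by (simp only: eq)
  have "pprov H (sseq (R \<union> P \<times> {y}) \<Gamma> \<Delta>)"
  proof (cases "z = x")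
    case True
    then have "R \<union> P \<times> {y} \<union> {(z, y)} = R \<union> P \<times> {y}" using assms(2) by blast
    then show ?thesis using p by (simp only:)
  next
    case False
    then have "(z, x) \<in> R" using insert.prems(2)[of z] by blast
    then have "(z, x) \<in> R \<union> P \<times> {y}" "(x, y) \<in> R \<union> P \<times> {y}"
      using assms(2) by auto
    with p show ?thesis by (rule pprov_tr1)
  qed
  then show ?case by (rule insert.IH) (use insert.prems(2) in blast)
qed

text \<open>The axiom covers atoms only. In the modal cases \<open>Suc x\<close> serves as the fresh
  label.\<close>

lemma pprov_id0: "pprov H ({}, {#(x, A)#}, {#(x, A)#})"
proof (induction A arbitrary: x)
  case (Atom p)
  then show ?case by (intro pprov_rule[OF mlabIK4_rule.id]) auto
next
  case Bot
  then show ?case using pprov_rule[OF mlabIK4_rule.botL[of "{}" x "{#}"]] by simp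
next
  case (And A B)
  have "pprov H ({}, {#} + {#(x, And A B)#}, {#} + {#(x, A)#})"
    by (rule pprov_rule1[OF mlabIK4_rule.andL1]) (use And in simp_all)
  moreover have "pprov H ({}, {#} + {#(x, And A B)#}, {#} + {#(x, B)#})"
    by (rule pprov_rule1[OF mlabIK4_rule.andL2]) (use And in simp_all)
  ultimately have "pprov H ({}, {#} + {#(x, And A B)#}, {#} + {#(x, And A B)#})"
    by (intro pprov_rule2[OF mlabIK4_rule.andR]) simp_all
  then show ?case by simp
next
  case (Or A B)
  have "pprov H ({}, {#} + {#(x, A)#}, {#} + {#(x, Or A B)#})"
    by (rule pprov_rule1[OF mlabIK4_rule.orR1]) (use Or in simp_all)
  moreover have "pprov H ({}, {#} + {#(x, B)#}, {#} + {#(x, Or A B)#})"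
    by (rule pprov_rule1[OF mlabIK4_rule.orR2]) (use Or in simp_all)
  ultimately have "pprov H ({}, {#} + {#(x, Or A B)#}, {#} + {#(x, Or A B)#})"
    by (intro pprov_rule2[OF mlabIK4_rule.orL]) simp_all
  then show ?case by simp
next
  case (Imp A B)
  have "pprov H ({}, {#(x, A)#} + {#} + {#(x, Imp A B)#}, {#} + {#(x, B)#})"
    by (rule pprov_rule2[OF mlabIK4_rule.impL]) (use Imp in auto)
  then show ?case
    using pprov_rule1[OF mlabIK4_rule.impR[of "{}" "{#(x, Imp A B)#}" x A B]]
    by (simp add: add_mset_commute)
next
  case (Box A)
  have "pprov H ({(x, Suc x)}, {#(Suc x, A)#}, {#(Suc x, A)#})"
    by (rule pprov_struct[OF Box]) auto
  then have "pprov H ({(x, Suc x)}, {#} + {#(x, Box A)#}, {#(Suc x, A)#})"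
    by (intro pprov_rule1[OF mlabIK4_rule.boxL[of x "Suc x"]]) simp_all
  then show ?case
    by (intro pprov_rule1[OF mlabIK4_rule.boxR[of "Suc x"]]) (auto simp: labels_of_def)
next
  case (Dia A)
  have "pprov H ({(x, Suc x)}, {#(Suc x, A)#}, {#(Suc x, A)#})"
    by (rule pprov_struct[OF Dia]) auto
  then have "pprov H ({(x, Suc x)}, {#(Suc x, A)#}, {#} + {#(x, Dia A)#})"
    by (intro pprov_rule1[OF mlabIK4_rule.diaR[of x "Suc x"]]) simp_all
  then show ?case
    using pprov_rule1[OF mlabIK4_rule.diaL[of "Suc x" "{}" "{#}" x A "{#(x, Dia A)#}"]]
    by (auto simp: labels_of_def)
qed

lemma pprov_id:
  assumes "a \<in> \<Gamma>" "a \<in> \<Delta>" "finite \<Gamma>" "finite \<Delta>" "finite R"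
  shows "pprov H (sseq R \<Gamma> \<Delta>)"
  using pprov_to_sseq[OF pprov_id0[of H "fst a" "snd a"], of R \<Gamma> \<Delta>] assms by simp

lemma pprov_id1:
  assumes "finite R" "a \<in># G" "a \<in># M"
  shows "pprov H (R, G, M)"
  using assms by (intro pprov_struct[OF pprov_id0[of H "fst a" "snd a"]]) auto

text \<open>Each clause describes a violated truth condition, and one rule with identity premisses
  proves it. Contraposed, unprovable complete sequents satisfy these conditions.\<close>

lemma
  assumes fin: "finite R" "finite \<Gamma>" "finite \<Delta>"
  shows pprov_botL: "(x, Bot) \<in> \<Gamma> \<Longrightarrow> pprov H (sseq R \<Gamma> \<Delta>)"
    and pprov_andL1: "(x, And B C) \<in> \<Gamma> \<Longrightarrow> (x, B) \<in> \<Delta> \<Longrightarrow> pprov H (sseq R \<Gamma> \<Delta>)"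
    and pprov_andL2: "(x, And B C) \<in> \<Gamma> \<Longrightarrow> (x, C) \<in> \<Delta> \<Longrightarrow> pprov H (sseq R \<Gamma> \<Delta>)"
    and pprov_andR: "(x, B) \<in> \<Gamma> \<Longrightarrow> (x, C) \<in> \<Gamma> \<Longrightarrow> (x, And B C) \<in> \<Delta> \<Longrightarrow> pprov H (sseq R \<Gamma> \<Delta>)"
    and pprov_orL: "(x, Or B C) \<in> \<Gamma> \<Longrightarrow> (x, B) \<in> \<Delta> \<Longrightarrow> (x, C) \<in> \<Delta> \<Longrightarrow> pprov H (sseq R \<Gamma> \<Delta>)"
    and pprov_orR1: "(x, B) \<in> \<Gamma> \<Longrightarrow> (x, Or B C) \<in> \<Delta> \<Longrightarrow> pprov H (sseq R \<Gamma> \<Delta>)"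
    and pprov_orR2: "(x, C) \<in> \<Gamma> \<Longrightarrow> (x, Or B C) \<in> \<Delta> \<Longrightarrow> pprov H (sseq R \<Gamma> \<Delta>)"
    and pprov_impL: "(x, Imp B C) \<in> \<Gamma> \<Longrightarrow> (x, B) \<in> \<Gamma> \<Longrightarrow> (x, C) \<in> \<Delta> \<Longrightarrow> pprov H (sseq R \<Gamma> \<Delta>)"
    and pprov_boxL: "(x, Box B) \<in> \<Gamma> \<Longrightarrow> (x, y) \<in> R \<Longrightarrow> (y, B) \<in> \<Delta> \<Longrightarrow> pprov H (sseq R \<Gamma> \<Delta>)"
    and pprov_diaR: "(x, Dia B) \<in> \<Delta> \<Longrightarrow> (x, y) \<in> R \<Longrightarrow> (y, B) \<in> \<Gamma> \<Longrightarrow> pprov H (sseq R \<Gamma> \<Delta>)"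
proof -
  note id = pprov_id1[OF fin(1), of a "{#a#}" "{#a#}" H for a, simplified]
  note conc = pprov_to_sseq[OF _ subset_refl fin(1) _ _ fin(2,3)]
  show "pprov H (sseq R \<Gamma> \<Delta>)" if "(x, Bot) \<in> \<Gamma>"
    by (rule conc[OF pprov_rule[OF mlabIK4_rule.botL[of R x "{#}" "{#}"]]]) (use that fin in auto)
  show "pprov H (sseq R \<Gamma> \<Delta>)" if "(x, And B C) \<in> \<Gamma>" "(x, B) \<in> \<Delta>"
    by (rule conc[OF pprov_rule1[OF mlabIK4_rule.andL1[of R "{#}" x B "{#(x, B)#}" C]]])
      (use that fin id in auto)
  show "pprov H (sseq R \<Gamma> \<Delta>)" if "(x, And B C) \<in> \<Gamma>" "(x, C) \<in> \<Delta>"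
    by (rule conc[OF pprov_rule1[OF mlabIK4_rule.andL2[of R "{#}" x C "{#(x, C)#}" B]]])
      (use that fin id in auto)
  show "pprov H (sseq R \<Gamma> \<Delta>)" if "(x, B) \<in> \<Gamma>" "(x, C) \<in> \<Gamma>" "(x, And B C) \<in> \<Delta>"
    by (rule conc[OF pprov_rule2[OF mlabIK4_rule.andR[of R "{#(x, B), (x, C)#}" "{#}" x B C]]])
      (use that fin in \<open>auto intro: pprov_id1[of _ "(x, B)"] pprov_id1[of _ "(x, C)"]\<close>)
  show "pprov H (sseq R \<Gamma> \<Delta>)" if "(x, Or B C) \<in> \<Gamma>" "(x, B) \<in> \<Delta>" "(x, C) \<in> \<Delta>"
    by (rule conc[OF pprov_rule2[OF mlabIK4_rule.orL[of R "{#}" x B "{#(x, B), (x, C)#}" C]]])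
      (use that fin in \<open>auto intro: pprov_id1[of _ "(x, B)"] pprov_id1[of _ "(x, C)"]\<close>)
  show "pprov H (sseq R \<Gamma> \<Delta>)" if "(x, B) \<in> \<Gamma>" "(x, Or B C) \<in> \<Delta>"
    by (rule conc[OF pprov_rule1[OF mlabIK4_rule.orR1[of R "{#(x, B)#}" "{#}" x B C]]])
      (use that fin id in auto)
  show "pprov H (sseq R \<Gamma> \<Delta>)" if "(x, C) \<in> \<Gamma>" "(x, Or B C) \<in> \<Delta>"
    by (rule conc[OF pprov_rule1[OF mlabIK4_rule.orR2[of R "{#(x, C)#}" "{#}" x C B]]])
      (use that fin id in auto)
  show "pprov H (sseq R \<Gamma> \<Delta>)" if "(x, Imp B C) \<in> \<Gamma>" "(x, B) \<in> \<Gamma>" "(x, C) \<in> \<Delta>"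
    by (rule conc[OF pprov_rule2[OF mlabIK4_rule.impL[of R "{#(x, B)#}" "{#}" x B "{#}" C "{#(x, C)#}"]]])
      (use that fin id in auto)
  show "pprov H (sseq R \<Gamma> \<Delta>)" if "(x, Box B) \<in> \<Gamma>" "(x, y) \<in> R" "(y, B) \<in> \<Delta>"
    by (rule conc[OF pprov_rule1[OF mlabIK4_rule.boxL[OF that(2), of "{#}" B "{#(y, B)#}"]]])
      (use that fin id in auto)
  show "pprov H (sseq R \<Gamma> \<Delta>)" if "(x, Dia B) \<in> \<Delta>" "(x, y) \<in> R" "(y, B) \<in> \<Gamma>"
    by (rule conc[OF pprov_rule1[OF mlabIK4_rule.diaR[OF that(2), of "{#(y, B)#}" "{#}" B]]])
      (use that fin id in auto)
qed

text \<open>Loeb's rule: cutting on \<open>y : \<box>B\<close> for each new child \<open>y\<close> yields an infinite spine along which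
  the successive children form a progressing trace.\<close>

lemma pprov_loeb:
  assumes Y: "infinite Y" and fin: "finite \<Gamma>" "finite \<Delta>" "finite R"
    and P: "P = insert x {z. (z, x) \<in> R}"
    and box: "(x, Box B) \<in> \<Delta>"
    and prem: "\<And>y. y \<in> Y \<Longrightarrow> y \<notin> Field R \<Longrightarrow> y \<notin> fst ` \<Gamma> \<Longrightarrow> y \<noteq> x \<Longrightarrow>
      pprov H (sseq (R \<union> P \<times> {y}) (insert (y, Box B) \<Gamma>) {(y, B)})"
  shows "pprov H (sseq R \<Gamma> \<Delta>)"
proof -
  define Y' where "Y' = Y - (Field R \<union> fst ` \<Gamma> \<union> {x})"
  define y where "y = enumerate Y'"
  \<comment> \<open>\<open>z i\<close> is the parent of \<open>y i\<close>: the label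
    \<open>x\<close> for \<open>i = 0\<close>, the previous spine label otherwise.\<close>
  define z where "z = case_nat x y"
  have Y': "infinite Y'"
    unfolding Y'_def by (rule Diff_infinite_finite) (use Y fin in \<open>auto simp: finite_Field\<close>)
  have y: "y i \<in> Y" "y i \<notin> Field R" "y i \<notin> fst ` \<Gamma>" "y i \<noteq> x" for i
    using enumerate_in_set[OF Y', of i] by (auto simp: Y'_def y_def)
  have y_inj: "y (Suc i) \<noteq> y i" for i
    using enumerate_step[OF Y', of i] by (simp add: y_def)
  have PF: "P \<subseteq> insert x (Field R)" by (auto simp: P Field_def)
  have finP: "finite P" using PF fin finite_subset by (blast intro: finite_Field)
  \<comment> \<open>Of the earlier spine labels only the edge from the parent is kept; this edge is
    the progress point contributed by the \<open>i\<close>-th sequent.\<close>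
  define sq where "sq i = sseq (R \<union> P \<times> {y i} \<union> {(z i, y i)}) \<Gamma> {(y i, B)}" for i
  have "pprov H (sq 0)"
  proof (rule pprov_macro[where X = UNIV and N = "\<lambda>i. {Suc i}"])
    fix i :: nat
    define H' where "H' = H \<union> sq ` {Suc i}"
    have zs: "z (Suc i) = y i" by (simp add: z_def)
    have "pprov H' (sq (Suc i))"
      by (rule pprov_hyp) (use fin finP in \<open>auto simp: H'_def sq_def\<close>)
    then have "pprov H' (sseq (R \<union> P \<times> {y i} \<union> {(y i, y (Suc i))} \<union> P \<times> {y (Suc i)}) \<Gamma> {(y (Suc i), B)})"
      unfolding sq_def zs by (rule pprov_sseq_mono) (use fin finP in auto)
    then have "pprov H' (sseq (R \<union> P \<times> {y i} \<union> {(y i, y (Suc i))}) \<Gamma> {(y (Suc i), B)})"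
      by (rule pprov_tr[OF finP, of "y i", rotated]) auto
    then have "pprov H' (sseq (R \<union> P \<times> {y i}) \<Gamma> {(y i, Box B), (y i, B)})"
    proof (rule pprov_boxR)
      have "Field (R \<union> P \<times> {y i}) \<subseteq> insert x (insert (y i) (Field R))"
        using PF by (auto simp: Field_def)
      then show "y (Suc i) \<notin> Field (R \<union> P \<times> {y i})"
        using y[of "Suc i"] y_inj[of i] by blast
    qed (use fin y[of "Suc i"] y_inj[of i] in auto)
    moreover have "pprov H' (sseq (R \<union> P \<times> {y i}) (insert (y i, Box B) \<Gamma>) {(y i, B)})"
      by (rule pprov_mono[OF prem[OF y]]) (auto simp: H'_def)
    ultimately have "pprov H' (sseq (R \<union> P \<times> {y i}) \<Gamma> {(y i, B)})"
      by (rule pprov_cut) (use fin in auto)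
    then have "pprov H' (sq i)"
      unfolding sq_def by (rule pprov_sseq_mono) (use fin finP in auto)
    then show "{Suc i} \<subseteq> UNIV \<and> pprov (H \<union> sq ` {Suc i}) (sq i)"
      by (simp add: H'_def)
  next
    fix f :: "nat \<Rightarrow> nat"
    assume f: "\<And>i. f i \<in> UNIV \<and> f (Suc i) \<in> {Suc (f i)}"
    define m where "m = f 0"
    have "f i = m + i" for i by (induction i) (use f in \<open>auto simp: m_def\<close>)
    then have "(z (m + k), z (m + Suc k)) \<in> rel_of (sq (f k))" for k
      by (simp add: sq_def z_def)
    then show "good (\<lambda>i. sq (f i))"
      unfolding good_def
      by (intro exI[of _ "\<lambda>k. z (m + k)"] exI[of _ "\<lambda>k. k"]) (auto simp: strict_mono_def)
  qed simp
  then have "pprov H (sseq (R \<union> {(x, y 0)} \<union> P \<times> {y 0}) \<Gamma> {(y 0, B)})"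
    unfolding sq_def by (rule pprov_sseq_mono) (use fin finP in \<open>auto simp: z_def\<close>)
  then have "pprov H (sseq (R \<union> {(x, y 0)}) \<Gamma> {(y 0, B)})"
    by (rule pprov_tr[OF finP, of x, rotated]) (auto simp: P)
  then show ?thesis
    by (rule pprov_boxR) (use box fin y in auto)
qed

text \<open>By cut, an undecided element of \<open>V\<close> can be put on one of the two sides
  without making the sequent provable. Disjointness from \<open>\<Delta>\<close> ensures that
  refuted formulas stay refuted.\<close>

lemma completion:
  assumes V: "finite V" and R: "finite R"
  shows "\<not> pprov H (sseq R \<Gamma> \<Delta>) \<Longrightarrow> \<Gamma> \<subseteq> V \<Longrightarrow> \<Delta> \<subseteq> V \<Longrightarrow>
    \<exists>\<Gamma>'. \<Gamma> \<subseteq> \<Gamma>' \<and> \<Gamma>' \<subseteq> V \<and> \<Gamma>' \<inter> \<Delta> = {} \<and> \<not> pprov H (sseq R \<Gamma>' (V - \<Gamma>'))"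
proof (induction "card (V - (\<Gamma> \<union> \<Delta>))" arbitrary: \<Gamma> \<Delta> rule: less_induct)
  case less
  have fin: "finite \<Gamma>" "finite \<Delta>" using less.prems V finite_subset by auto
  have disj: "\<Gamma> \<inter> \<Delta> = {}"
    using less.prems(1) pprov_id[OF _ _ fin R] by blast
  show ?case
  proof (cases "V \<subseteq> \<Gamma> \<union> \<Delta>")
    case True
    then have "V - \<Gamma> = \<Delta>" using less.prems disj by blast
    then show ?thesis using less.prems disj by (intro exI[of _ \<Gamma>]) simp
  next
    case False
    then obtain a where a: "a \<in> V" "a \<notin> \<Gamma> \<union> \<Delta>" by blast
    obtain x A where xA: "a = (x, A)" by force
    have lt: "card (V - (insert a \<Gamma> \<union> \<Delta>)) < card (V - (\<Gamma> \<union> \<Delta>))"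
      "card (V - (\<Gamma> \<union> insert a \<Delta>)) < card (V - (\<Gamma> \<union> \<Delta>))"
      by (rule psubset_card_mono; use a V in blast)+
    consider "\<not> pprov H (sseq R (insert a \<Gamma>) \<Delta>)" | "\<not> pprov H (sseq R \<Gamma> (insert a \<Delta>))"
      using pprov_cut[of H R \<Gamma> x A \<Delta>] less.prems(1) fin unfolding xA by blast
    then show ?thesis
    proof cases
      case 1
      have "\<exists>\<Gamma>'. insert a \<Gamma> \<subseteq> \<Gamma>' \<and> \<Gamma>' \<subseteq> V \<and> \<Gamma>' \<inter> \<Delta> = {} \<and> \<not> pprov H (sseq R \<Gamma>' (V - \<Gamma>'))"
        by (rule less.hyps[OF lt(1) 1]) (use less.prems(2,3) a in blast)+
      then show ?thesis by (elim ex_forward) simp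
    next
      case 2
      have "\<exists>\<Gamma>'. \<Gamma> \<subseteq> \<Gamma>' \<and> \<Gamma>' \<subseteq> V \<and> \<Gamma>' \<inter> insert a \<Delta> = {} \<and> \<not> pprov H (sseq R \<Gamma>' (V - \<Gamma>'))"
        by (rule less.hyps[OF lt(2) 2]) (use less.prems(2,3) a in blast)+
      then show ?thesis by (elim ex_forward) simp
    qed
  qed
qed

section \<open>Stages of a monotone operator\<close>

text \<open>Ordinals below are the elements of a well-order on \<^typ>\<open>'a set\<close>; by Cantor's theorem it is
  long enough for the stages of an operator on \<^typ>\<open>'a set\<close> to exhaust its least fixed point.\<close>

definition ord :: "'a set rel" where
  "ord = (SOME r. well_order_on UNIV r) - Id"

lemma well_order_SOME: "well_order_on UNIV (SOME r :: 'a rel. well_order_on UNIV r)"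
  by (rule someI_ex) (rule well_order_on)

lemma wf_ord: "wf ord"
  using well_order_SOME unfolding ord_def well_order_on_def by blast

lemma ord_total: "a = b \<or> (a, b) \<in> ord \<or> (b, a) \<in> ord"
  using well_order_SOME[where 'a = "'a set"]
  unfolding ord_def well_order_on_def linear_order_on_def total_on_def by blast

lemma ord_irrefl: "(a, a) \<notin> ord"
  by (simp add: ord_def)

lemma ord_trans:
  assumes "(a, b) \<in> ord" "(b, c) \<in> ord"
  shows "(a, c) \<in> ord"
proof -
  define r where "r = (SOME r :: 'a set rel. well_order_on UNIV r)"
  have "well_order_on UNIV r" unfolding r_def by (rule well_order_SOME)
  then have "trans r" "antisym r"
    by (simp_all add: well_order_on_def linear_order_on_def partial_order_on_def preorder_on_def)
  moreover have "(a, b) \<in> r" "(b, c) \<in> r" "a \<noteq> b"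
    using assms by (simp_all add: ord_def r_def)
  ultimately have "(a, c) \<in> r" "a \<noteq> c"
    by (auto dest: transD antisymD)
  then show ?thesis by (simp add: ord_def r_def)
qed

definition stage :: "('a set \<Rightarrow> 'a set) \<Rightarrow> 'a set \<Rightarrow> 'a set" where
  "stage E = wfrec ord (\<lambda>f a. E (\<Union>b\<in>{b. (b, a) \<in> ord}. f b))"

definition below :: "('a set \<Rightarrow> 'a set) \<Rightarrow> 'a set \<Rightarrow> 'a set" where
  "below E a = (\<Union>b\<in>{b. (b, a) \<in> ord}. stage E b)"

lemma stage_unfold: "stage E a = E (below E a)"
proof -
  have "stage E a = E (\<Union>b\<in>{b. (b, a) \<in> ord}. cut (stage E) ord a b)"
    unfolding stage_def by (subst wfrec[OF wf_ord]) simp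
  also have "(\<Union>b\<in>{b. (b, a) \<in> ord}. cut (stage E) ord a b) = below E a"
    unfolding below_def by (simp add: cut_apply)
  finally show ?thesis .
qed

text \<open>If every stage contributed a new element, choosing one for each would inject
  \<open>'a set\<close> into \<open>'a\<close>. So some stage adds nothing to the union of the
  earlier ones, which is then closed under \<open>E\<close>.\<close>

lemma lfp_subset_stages:
  assumes "x \<in> lfp E"
  shows "\<exists>a. x \<in> stage E a"
proof -
  have "\<exists>a. stage E a \<subseteq> below E a"
  proof (rule ccontr)
    assume "\<not> ?thesis"
    then have "\<forall>a. \<exists>y. y \<in> stage E a \<and> y \<notin> below E a" by blast
    then obtain e where e: "\<And>a. e a \<in> stage E a \<and> e a \<notin> below E a" by metis
    have "inj e"
    proof (rule injI)
      fix a b assume "e a = e b"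
      then show "a = b"
        using e[of a] e[of b] ord_total[of a b] by (auto simp: below_def)
    qed
    then have "surj (inv e)" by (rule inj_imp_surj_inv)
    then show False using Cantors_theorem[of UNIV] by auto
  qed
  then obtain a where "E (below E a) \<subseteq> below E a" by (auto simp: stage_unfold)
  then have "lfp E \<subseteq> below E a" by (rule lfp_lowerbound)
  then show ?thesis using assms by (auto simp: below_def)
qed

text \<open>Ranks at different positions are stages of different operators; this induction along
  \<open>ord\<close> makes them comparable.\<close>

lemma
  assumes "mono E" and E': "\<And>Z. E' Z \<subseteq> E Z"
  shows stage_mono: "stage E' a \<subseteq> stage E a" and below_mono: "below E' a \<subseteq> below E a"
proof -
  show st: "stage E' a \<subseteq> stage E a" for a
    using wf_ord
  proof (induction a rule: wf_induct_rule)
    case (less a)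
    then have "below E' a \<subseteq> below E a" unfolding below_def by blast
    then have "E (below E' a) \<subseteq> E (below E a)" by (rule monoD[OF assms(1)])
    then show ?case using E'[of "below E' a"] by (simp add: stage_unfold)
  qed
  show "below E' a \<subseteq> below E a" unfolding below_def using st by blast
qed

lemma infinite_Union_strict_chain:
  assumes "\<And>i::nat. C i \<subset> C (Suc i)"
  shows "infinite (\<Union>i. C i)"
proof
  assume fin: "finite (\<Union>i. C i)"
  have "finite (C i)" for i by (rule finite_subset[OF _ fin]) auto
  then have "strict_mono (\<lambda>i. card (C i))"
    using assms by (simp add: strict_mono_Suc_iff psubset_card_mono)
  then have "Suc (card (\<Union>i. C i)) \<le> card (C (Suc (card (\<Union>i. C i))))"
    by (rule strict_mono_imp_increasing)
  moreover have "card (C i) \<le> card (\<Union>i. C i)" for i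
    by (rule card_mono[OF fin]) auto
  ultimately show False by (metis not_less_eq_eq)
qed

section \<open>Positions\<close>

text \<open>A position is a complete sequent over a finite tree of labels with root \<open>x0\<close>: every formula
  in \<open>lab p \<times> Sub\<close> that is not in the antecedent is in the succedent.  The tag of a label
  records the formula \<open>\<box>B\<close> or \<open>\<diamond>B\<close> for which the label was created.\<close>

type_synonym 'p pos = "(label \<times> label) set \<times> 'p lform set"

definition is_dia :: "'p form \<Rightarrow> bool" where
  "is_dia C \<longleftrightarrow> (\<exists>B. C = Dia B)"

text \<open>Relations are kept transitive, so parenthood in the tree is recovered as the covering
  relation.\<close>

definition child :: "(label \<times> label) set \<Rightarrow> label \<Rightarrow> label \<Rightarrow> bool" where
  "child R x y \<longleftrightarrow> (x, y) \<in> R \<and> (\<forall>z. (x, z) \<in> R \<longrightarrow> (z, y) \<notin> R)"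

text \<open>Fixing the tags of all labels in advance keeps positions plain pairs; with infinitely
  many labels per tag, a fresh one is always at hand.\<close>

locale tagged_language =
  fixes x0 :: label and Sub :: "'p form set" and tag :: "label \<Rightarrow> 'p form"
  assumes finite_Sub: "finite Sub"
    and Sub_And: "\<And>B C. And B C \<in> Sub \<Longrightarrow> B \<in> Sub \<and> C \<in> Sub"
    and Sub_Or: "\<And>B C. Or B C \<in> Sub \<Longrightarrow> B \<in> Sub \<and> C \<in> Sub"
    and Sub_Imp: "\<And>B C. Imp B C \<in> Sub \<Longrightarrow> B \<in> Sub \<and> C \<in> Sub"
    and Sub_Box: "\<And>B. Box B \<in> Sub \<Longrightarrow> B \<in> Sub"
    and Sub_Dia: "\<And>B. Dia B \<in> Sub \<Longrightarrow> B \<in> Sub"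
    and infinite_tag: "\<And>C. C \<in> Sub \<Longrightarrow> infinite {y. tag y = C}"
begin

definition lab :: "'p pos \<Rightarrow> label set" where
  "lab p = insert x0 (Range (fst p))"

definition seqn :: "'p pos \<Rightarrow> 'p sequent" where
  "seqn p = sseq (fst p) (snd p) (lab p \<times> Sub - snd p)"

text \<open>This is what the creation of a label guarantees: truth of \<open>Box B\<close> at a
  label made for \<open>Box B\<close> comes from Loeb's rule, and a label made for
  \<open>Dia B\<close> is its witness.\<close>

definition tag_ok :: "'p lform set \<Rightarrow> label \<Rightarrow> bool" where
  "tag_ok \<Gamma> y \<longleftrightarrow> tag y \<in> Sub \<and>
     (\<exists>B. tag y = Box B \<and> (y, Box B) \<in> \<Gamma> \<or> tag y = Dia B \<and> (y, B) \<in> \<Gamma>)"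

text \<open>The relation is the strict order of a finite tree. The last two clauses supply the two
  bounds by the size of \<open>Sub\<close>: on box labels along a path and on diamond children of a
  label.\<close>

definition position :: "'p pos \<Rightarrow> bool" where
  "position p \<longleftrightarrow> finite (fst p) \<and> Domain (fst p) \<subseteq> lab p \<and> x0 \<notin> Range (fst p) \<and>
     trans (fst p) \<and> irrefl (fst p) \<and>
     (\<forall>a b y. (a, y) \<in> fst p \<longrightarrow> (b, y) \<in> fst p \<longrightarrow> a = b \<or> (a, b) \<in> fst p \<or> (b, a) \<in> fst p) \<and>
     snd p \<subseteq> lab p \<times> Sub \<and>
     (\<forall>y\<in>Range (fst p). tag_ok (snd p) y) \<and>
     (\<forall>y z B. (y, z) \<in> fst p \<longrightarrow> y \<in> Range (fst p) \<longrightarrow> tag y = Box B \<longrightarrow> tag z \<noteq> Box B) \<and>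
     (\<forall>x y z B. child (fst p) x y \<longrightarrow> child (fst p) x z \<longrightarrow> tag y = Dia B \<longrightarrow> tag z = Dia B \<longrightarrow> y = z)"

text \<open>The last clause makes these end extensions: what lies between two old labels never
  changes, so components can only grow.\<close>

definition ext :: "'p pos \<Rightarrow> 'p pos \<Rightarrow> bool" where
  "ext p q \<longleftrightarrow> fst p \<subseteq> fst q \<and> snd p \<subseteq> snd q \<and>
     (\<forall>a y. (a, y) \<in> fst q \<longrightarrow> y \<in> lab p \<longrightarrow> (a, y) \<in> fst p)"

definition cmp :: "(label \<times> label) set \<Rightarrow> label \<Rightarrow> label set" where
  "cmp R n = {y. (n, y) \<in> R \<and> is_dia (tag y) \<and> (\<forall>z. (n, z) \<in> R \<longrightarrow> (z, y) \<in> R \<longrightarrow> is_dia (tag z))}"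

lemma position_simps:
  assumes "position p"
  shows "finite (fst p)" "Domain (fst p) \<subseteq> lab p" "x0 \<notin> Range (fst p)" "trans (fst p)" "irrefl (fst p)"
    "snd p \<subseteq> lab p \<times> Sub"
  using assms unfolding position_def by simp_all

lemma finite_lab: "position p \<Longrightarrow> finite (lab p)"
  unfolding lab_def position_def by (simp add: finite_Range)

lemma finite_vertices: "position p \<Longrightarrow> finite (lab p \<times> Sub)"
  using finite_lab finite_Sub by simp

lemma finite_snd: "position p \<Longrightarrow> finite (snd p)"
  using finite_vertices position_simps(6) finite_subset by blast

lemma position_in_lab:
  assumes "position p" "(x, y) \<in> fst p"
  shows "x \<in> lab p" "y \<in> lab p"
  using assms position_simps(2)[OF assms(1)] by (auto simp: lab_def)

lemma ext_refl: "ext p p"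
  by (simp add: ext_def)

lemma lab_mono: "ext p q \<Longrightarrow> lab p \<subseteq> lab q"
  unfolding ext_def lab_def by auto

lemma ext_trans:
  assumes "ext p q" "ext q r"
  shows "ext p r"
  using assms lab_mono[OF assms(1)] unfolding ext_def by (meson order_trans subsetD)

lemma ext_antisym: "ext p q \<Longrightarrow> ext q p \<Longrightarrow> p = q"
  unfolding ext_def prod_eq_iff by (meson subset_antisym)

lemma cmp_mono:
  assumes "position p" "ext p q"
  shows "cmp (fst p) n \<subseteq> cmp (fst q) n"
proof
  fix y assume y: "y \<in> cmp (fst p) n"
  then have "(n, y) \<in> fst p" by (simp add: cmp_def)
  then have ylab: "y \<in> lab p" using position_in_lab[OF assms(1)] by blast
  have "is_dia (tag z)" if "(n, z) \<in> fst q" "(z, y) \<in> fst q" for z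
  proof -
    have "(z, y) \<in> fst p" using that(2) ylab assms(2) unfolding ext_def by blast
    then have "z \<in> lab p" using position_in_lab[OF assms(1)] by blast
    then have "(n, z) \<in> fst p" using that(1) assms(2) unfolding ext_def by blast
    then show ?thesis using y \<open>(z, y) \<in> fst p\<close> by (simp add: cmp_def)
  qed
  then show "y \<in> cmp (fst q) n"
    using y assms(2) unfolding cmp_def ext_def by blast
qed

lemma
  assumes p: "position p" and u: "\<not> pprov H (seqn p)" and x: "x \<in> lab p"
  shows local_Bot: "(x, Bot) \<notin> snd p"
    and local_And: "And B C \<in> Sub \<Longrightarrow> (x, And B C) \<in> snd p \<longleftrightarrow> (x, B) \<in> snd p \<and> (x, C) \<in> snd p"
    and local_Or: "Or B C \<in> Sub \<Longrightarrow> (x, Or B C) \<in> snd p \<longleftrightarrow> (x, B) \<in> snd p \<or> (x, C) \<in> snd p"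
    and local_Imp: "Imp B C \<in> Sub \<Longrightarrow> (x, Imp B C) \<in> snd p \<Longrightarrow> (x, B) \<in> snd p \<Longrightarrow> (x, C) \<in> snd p"
    and local_Box: "Box B \<in> Sub \<Longrightarrow> (x, Box B) \<in> snd p \<Longrightarrow> (x, y) \<in> fst p \<Longrightarrow> (y, B) \<in> snd p"
    and local_Dia: "Dia B \<in> Sub \<Longrightarrow> (x, y) \<in> fst p \<Longrightarrow> (y, B) \<in> snd p \<Longrightarrow> (x, Dia B) \<in> snd p"
proof -
  have fin: "finite (fst p)" "finite (snd p)" "finite (lab p \<times> Sub - snd p)"
    using position_simps[OF p] finite_snd[OF p] finite_vertices[OF p] by auto
  note u' = u[unfolded seqn_def]
  show "(x, Bot) \<notin> snd p" using pprov_botL[OF fin] u' by blast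
  show "(x, And B C) \<in> snd p \<longleftrightarrow> (x, B) \<in> snd p \<and> (x, C) \<in> snd p" if s: "And B C \<in> Sub"
    using pprov_andL1[OF fin, of x B C H] pprov_andL2[OF fin, of x B C H] pprov_andR[OF fin, of x B C H]
      u' x s Sub_And[OF s] by auto
  show "(x, Or B C) \<in> snd p \<longleftrightarrow> (x, B) \<in> snd p \<or> (x, C) \<in> snd p" if s: "Or B C \<in> Sub"
    using pprov_orL[OF fin, of x B C H] pprov_orR1[OF fin, of x B C H] pprov_orR2[OF fin, of x C B H]
      u' x s Sub_Or[OF s] by auto
  show "(x, C) \<in> snd p" if s: "Imp B C \<in> Sub" and m: "(x, Imp B C) \<in> snd p" "(x, B) \<in> snd p"
    using pprov_impL[OF fin m, of H] u' x Sub_Imp[OF s] by auto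
  show "(y, B) \<in> snd p" if s: "Box B \<in> Sub" and m: "(x, Box B) \<in> snd p" "(x, y) \<in> fst p"
    using pprov_boxL[OF fin m, of H] u' position_in_lab(2)[OF p m(2)] Sub_Box[OF s] by auto
  show "(x, Dia B) \<in> snd p" if s: "Dia B \<in> Sub" and m: "(x, y) \<in> fst p" "(y, B) \<in> snd p"
    using pprov_diaR[OF fin _ m, of H] u' s x by auto
qed

text \<open>The new leaf \<open>y\<close> is placed above \<open>x\<close> and all predecessors of
  \<open>x\<close>, which keeps the relation transitive and tree-like and makes \<open>x\<close> the
  parent of \<open>y\<close>. The assumptions \<open>box\<close> and \<open>dia\<close> are the two
  tag conditions for the new leaf.\<close>

lemma add_label:
  assumes p: "position p" and x: "x \<in> lab p" and y: "y \<notin> lab p"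
    and P: "P = insert x {z. (z, x) \<in> fst p}"
    and G: "snd p \<subseteq> G" "G \<subseteq> insert y (lab p) \<times> Sub"
    and tagy: "tag_ok G y"
    and box: "\<forall>z\<in>P. \<forall>B. z \<in> Range (fst p) \<longrightarrow> tag z = Box B \<longrightarrow> tag y \<noteq> Box B"
    and dia: "\<forall>z B. (x, z) \<in> fst p \<longrightarrow> tag z = Dia B \<longrightarrow> tag y \<noteq> Dia B"
    and q: "q = (fst p \<union> P \<times> {y}, G)"
  shows "position q" "ext p q" "lab q = insert y (lab p)"
    "is_dia (tag y) \<Longrightarrow> y \<in> cmp (fst q) x"
    "is_dia (tag y) \<Longrightarrow> x \<in> cmp (fst p) n \<Longrightarrow> y \<in> cmp (fst q) n"
proof -
  define R where "R = fst p"
  note pd = position_simps[OF p, folded R_def]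
  have lin: "\<And>a b w. (a, w) \<in> R \<Longrightarrow> (b, w) \<in> R \<Longrightarrow> a = b \<or> (a, b) \<in> R \<or> (b, a) \<in> R"
    and tagR: "\<And>w. w \<in> Range R \<Longrightarrow> tag_ok (snd p) w"
    and boxR: "\<And>w z B. (w, z) \<in> R \<Longrightarrow> w \<in> Range R \<Longrightarrow> tag w = Box B \<Longrightarrow> tag z \<noteq> Box B"
    and diaR: "\<And>v w z B. child R v w \<Longrightarrow> child R v z \<Longrightarrow> tag w = Dia B \<Longrightarrow> tag z = Dia B \<Longrightarrow> w = z"
    using p unfolding position_def R_def by blast+
  have inlab: "(a, b) \<in> R \<Longrightarrow> a \<in> lab p \<and> b \<in> lab p" for a b
    using position_in_lab[OF p] by (auto simp: R_def)
  have yR: "(a, y) \<notin> R" "(y, a) \<notin> R" for a using inlab y by blast+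
  have Plab: "P \<subseteq> lab p" using x inlab by (auto simp: P R_def)
  have yP: "y \<notin> P" using Plab y by blast
  have xP: "x \<in> P" by (simp add: P)
  have Pdown: "a \<in> P" if "(a, b) \<in> R" "b \<in> P" for a b
    using that transD[OF pd(4)] by (auto simp: P R_def)
  have Plin: "a = b \<or> (a, b) \<in> R \<or> (b, a) \<in> R" if "a \<in> P" "b \<in> P" for a b
    using that lin by (auto simp: P R_def)
  have Px: "a = x \<or> (a, x) \<in> R" if "a \<in> P" for a using that by (auto simp: P R_def)
  have irr: "(a, a) \<notin> R" for a using pd(5) by (auto simp: irrefl_def)
  have xx: "\<not> ((x, z) \<in> R \<and> z \<in> P)" for z
    using Px[of z] irr transD[OF pd(4)] by blast
  have finP: "finite P" using finite_lab[OF p] Plab finite_subset by blast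
  define R' where "R' = R \<union> P \<times> {y}"
  have R'y: "(a, y) \<in> R' \<longleftrightarrow> a \<in> P" and yR': "(y, a) \<notin> R'"
    and R'n: "b \<noteq> y \<Longrightarrow> (a, b) \<in> R' \<longleftrightarrow> (a, b) \<in> R" for a b
    using yR yP by (auto simp: R'_def)
  have q': "fst q = R'" "snd q = G" by (simp_all add: q R'_def R_def)
  have RangeR': "Range R' = insert y (Range R)" using xP by (auto simp: R'_def)
  show lab: "lab q = insert y (lab p)"
    by (auto simp: lab_def q' RangeR' R_def)
  have tr: "trans R'"
  proof (rule transI)
    fix a b c assume ab: "(a, b) \<in> R'" and bc: "(b, c) \<in> R'"
    then have "b \<noteq> y" using yR' by blast
    then have ab: "(a, b) \<in> R" using ab R'n by blast
    show "(a, c) \<in> R'"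
    proof (cases "c = y")
      case True
      then show ?thesis using bc ab Pdown R'y by blast
    next
      case False
      then show ?thesis using bc ab transD[OF pd(4)] R'n by blast
    qed
  qed
  have lin': "a = b \<or> (a, b) \<in> R' \<or> (b, a) \<in> R'" if "(a, w) \<in> R'" "(b, w) \<in> R'" for a b w
  proof (cases "w = y")
    case True
    then show ?thesis using that Plin R'y unfolding R'_def by blast
  next
    case False
    then show ?thesis using that lin R'n unfolding R'_def by blast
  qed
  have childR: "w \<noteq> y \<and> child R v w \<or> w = y \<and> v = x" if c: "child R' v w" for v w
  proof (cases "w = y")
    case True
    then have "v \<in> P" using c R'y by (simp add: child_def)
    moreover have "(v, x) \<notin> R"
      using c True R'y xP unfolding child_def R'_def by blast
    ultimately show ?thesis using Px True by blast
  next
    case False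
    then show ?thesis using c R'n unfolding child_def R'_def by blast
  qed
  have dia': "w = z" if c: "child R' v w" "child R' v z" and t: "tag w = Dia B" "tag z = Dia B" for v w z B
  proof -
    have "(x, z') \<in> R" if "child R x z'" for z' using that by (simp add: child_def)
    then show ?thesis
      using childR[OF c(1)] childR[OF c(2)] t dia diaR unfolding R_def by metis
  qed
  have box': "tag z \<noteq> Box B" if "(w, z) \<in> R'" "w \<in> Range R'" "tag w = Box B" for w z B
  proof -
    have "w \<noteq> y" using that(1) yR'[of z] by metis
    then have "w \<in> Range R" using that(2) RangeR' by simp
    then show ?thesis
      using that boxR box R'n R'y unfolding R_def by (cases "z = y") blast+
  qed
  have "tag_ok G w" if "w \<in> Range R'" for w
    using that tagy tagR[of w] G(1) unfolding RangeR' tag_ok_def by blast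
  then have c1: "\<forall>w\<in>Range R'. tag_ok G w" by blast
  have c2: "finite R'" using pd(1) finP by (simp add: R'_def)
  have c3: "Domain R' \<subseteq> lab q" using pd(2) Plab unfolding lab R'_def by blast
  have c4: "x0 \<notin> Range R'" using pd(3) y by (auto simp: RangeR' lab_def)
  have c5: "irrefl R'" using irr yP by (auto simp: irrefl_def R'_def)
  have c6: "\<forall>a b w. (a, w) \<in> R' \<longrightarrow> (b, w) \<in> R' \<longrightarrow> a = b \<or> (a, b) \<in> R' \<or> (b, a) \<in> R'"
    using lin' by simp
  have c7: "\<forall>w z B. (w, z) \<in> R' \<longrightarrow> w \<in> Range R' \<longrightarrow> tag w = Box B \<longrightarrow> tag z \<noteq> Box B"
    using box' by simp
  have c8: "\<forall>v w z B. child R' v w \<longrightarrow> child R' v z \<longrightarrow> tag w = Dia B \<longrightarrow> tag z = Dia B \<longrightarrow> w = z"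
    using dia' by simp
  have c9: "G \<subseteq> lab q \<times> Sub" using G(2) lab by simp
  show "position q"
    unfolding position_def q' by (intro conjI c1 c2 c3 c4 tr c5 c6 c7 c8 c9)
  show "ext p q"
    unfolding ext_def q' using G(1) y R'n by (auto simp: R_def[symmetric] R'_def)
  show "y \<in> cmp (fst q) x" if "is_dia (tag y)"
  proof -
    have no: "(z, y) \<notin> R'" if "(x, z) \<in> R'" for z
    proof
      assume "(z, y) \<in> R'"
      then have zP: "z \<in> P" using R'y by simp
      then have "z \<noteq> y" using yP by auto
      then have "(x, z) \<in> R" using that R'n by simp
      then show False using xx[of z] zP by simp
    qed
    show ?thesis using no that xP R'y[of x] by (simp add: cmp_def q')
  qed
  show "y \<in> cmp (fst q) n" if d: "is_dia (tag y)" and xn: "x \<in> cmp (fst p) n"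
  proof -
    have nx: "(n, x) \<in> R" using xn by (simp add: cmp_def R_def)
    have "is_dia (tag z)" if z: "(n, z) \<in> R'" "(z, y) \<in> R'" for z
    proof -
      have zP: "z \<in> P" using z R'y by simp
      then have "z \<noteq> y" using yP by auto
      then have "(n, z) \<in> R" using z R'n by simp
      then show ?thesis using Px[OF zP] xn by (auto simp: cmp_def R_def)
    qed
    moreover have "(n, y) \<in> R'" using Pdown[OF nx xP] R'y by simp
    ultimately show ?thesis using d by (simp add: cmp_def q')
  qed
qed

section \<open>Unprovable extensions that answer a formula\<close>

lemma enlarge_position:
  assumes p: "position p" and G: "snd p \<subseteq> G" "G \<subseteq> lab p \<times> Sub" and q: "q = (fst p, G)"
  shows "position q" "ext p q" "lab q = lab p"
proof -
  show lab: "lab q = lab p" by (simp add: lab_def q)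
  have "tag_ok (snd q) y" if "tag_ok (snd p) y" for y
    using that G(1) unfolding tag_ok_def q by auto
  then show "position q"
    using p G(2) unfolding position_def lab by (simp add: q)
  show "ext p q" using G(1) by (simp add: ext_def q)
qed

text \<open>The premiss has only \<open>x:C\<close> on the right, so formulas refuted in
  \<open>p\<close> may become true: the answer belongs to a later world. \<open>H\<close> is
  arbitrary because answers also have to avoid forbidden positions.\<close>

lemma answer_Imp:
  assumes p: "position p" and u: "\<not> pprov H (seqn p)" and x: "x \<in> lab p"
    and s: "Imp B C \<in> Sub" "(x, Imp B C) \<notin> snd p"
  shows "\<exists>q. position q \<and> ext p q \<and> \<not> pprov H (seqn q) \<and> (x, B) \<in> snd q \<and> (x, C) \<notin> snd q"
proof -
  let ?V = "lab p \<times> Sub"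
  have fin: "finite (fst p)" "finite (snd p)" "finite ?V"
    using position_simps(1)[OF p] finite_snd[OF p] finite_vertices[OF p] by auto
  have "\<not> pprov H (sseq (fst p) (insert (x, B) (snd p)) {(x, C)})"
  proof
    assume "pprov H (sseq (fst p) (insert (x, B) (snd p)) {(x, C)})"
    then have "pprov H (sseq (fst p) (snd p) (?V - snd p))"
      by (rule pprov_impR) (use x s fin in auto)
    then show False using u by (simp add: seqn_def)
  qed
  from completion[OF fin(3,1) this]
  obtain G where G: "insert (x, B) (snd p) \<subseteq> G" "G \<subseteq> ?V" "G \<inter> {(x, C)} = {}"
      "\<not> pprov H (sseq (fst p) G (?V - G))"
    using x Sub_Imp[OF s(1)] position_simps(6)[OF p] by auto
  define q where "q = (fst p, G)"
  note q = enlarge_position[OF p _ G(2) q_def]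
  have "snd p \<subseteq> G" using G(1) by simp
  moreover have "\<not> pprov H (seqn q)"
    using G(4) q(3)[OF calculation] by (simp add: seqn_def q_def)
  ultimately show ?thesis
    using q(1,2) G(1,3) by (intro exI[of _ q]) (auto simp: q_def)
qed

text \<open>Loeb's rule, contraposed, provides a counterexample \<open>y\<close> to \<open>B\<close>
  at which \<open>Box B\<close> holds.\<close>

lemma answer_Box:
  assumes p: "position p" and u: "\<not> pprov H (seqn p)" and x: "x \<in> lab p"
    and s: "Box B \<in> Sub" "(x, Box B) \<notin> snd p"
  shows "\<exists>q y. position q \<and> ext p q \<and> \<not> pprov H (seqn q) \<and> y \<in> lab q \<and> (x, y) \<in> fst q \<and> (y, B) \<notin> snd q"
proof -
  let ?V = "lab p \<times> Sub" and ?Y = "{y. tag y = Box B} - lab p"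
  define P where "P = insert x {z. (z, x) \<in> fst p}"
  have fin: "finite (fst p)" "finite (snd p)" "finite ?V"
    using position_simps(1)[OF p] finite_snd[OF p] finite_vertices[OF p] by auto
  have Y: "infinite ?Y"
    using infinite_tag[OF s(1)] finite_lab[OF p] by (simp add: Diff_infinite_finite)
  obtain y where y: "y \<in> ?Y"
    "\<not> pprov H (sseq (fst p \<union> P \<times> {y}) (insert (y, Box B) (snd p)) {(y, B)})"
    using pprov_loeb[OF Y fin(2) finite_Diff[OF fin(3)] fin(1) P_def, of B "snd p" H] u s x
    unfolding seqn_def by blast
  have Plab: "P \<subseteq> lab p" using x position_in_lab(1)[OF p] by (auto simp: P_def)
  have finP: "finite P" using Plab finite_lab[OF p] finite_subset by blast
  have fin': "finite (insert y (lab p) \<times> Sub)" "finite (fst p \<union> P \<times> {y})"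
    using finite_lab[OF p] finite_Sub fin finP by auto
  from completion[OF fin' y(2)]
  obtain G where G: "insert (y, Box B) (snd p) \<subseteq> G" "G \<subseteq> insert y (lab p) \<times> Sub"
      "G \<inter> {(y, B)} = {}"
      "\<not> pprov H (sseq (fst p \<union> P \<times> {y}) G (insert y (lab p) \<times> Sub - G))"
    using s(1) Sub_Box[OF s(1)] position_simps(6)[OF p] by auto
  define q where "q = (fst p \<union> P \<times> {y}, G)"
  \<comment> \<open>A predecessor of \<open>y\<close> with this tag satisfies \<open>Box B\<close>
    by \<open>tag_ok\<close>, which would force \<open>B\<close> at \<open>y\<close>.\<close>
  have box: "tag z \<noteq> Box B" if z: "z \<in> P" "z \<in> Range (fst p)" for z
  proof
    assume tz: "tag z = Box B"
    have "tag_ok (snd p) z" using p z(2) unfolding position_def by blast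
    then have "(z, Box B) \<in> G" using tz G(1) by (auto simp: tag_ok_def)
    moreover have "(y, B) \<in> insert y (lab p) \<times> Sub - G" using G(3) Sub_Box[OF s(1)] by auto
    ultimately have "pprov H (sseq (fst p \<union> P \<times> {y}) G (insert y (lab p) \<times> Sub - G))"
      using z(1) fin' finite_subset[OF G(2) fin'(1)] by (intro pprov_boxL[of _ _ _ z B y]) auto
    then show False using G(4) by simp
  qed
  have sG: "snd p \<subseteq> G" and tagy: "tag_ok G y" and y': "y \<notin> lab p"
    using y(1) s(1) G(1) by (auto simp: tag_ok_def)
  have box': "\<forall>z\<in>P. \<forall>C. z \<in> Range (fst p) \<longrightarrow> tag z = Box C \<longrightarrow> tag y \<noteq> Box C"
    using box y(1) by auto
  have dia': "\<forall>z C. (x, z) \<in> fst p \<longrightarrow> tag z = Dia C \<longrightarrow> tag y \<noteq> Dia C"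
    using y(1) by auto
  note q = add_label[OF p x y' P_def sG G(2) tagy box' dia' q_def]
  have "\<not> pprov H (seqn q)" using G(4) by (simp add: seqn_def q(3)) (simp add: q_def)
  then show ?thesis
    using q(1-3) G(3) by (intro exI[of _ q] exI[of _ y]) (auto simp: q_def P_def)
qed

text \<open>The left diamond rule keeps the succedent, so a witness can be added without changing
  any truth value at old labels. Being in the component of \<open>x\<close> and in every component
  containing \<open>x\<close>, the new label can be traced back to older ones.\<close>

lemma answer_Dia:
  assumes p: "position p" and u: "\<not> pprov H (seqn p)" and x: "x \<in> lab p"
    and s: "Dia B \<in> Sub" "(x, Dia B) \<in> snd p"
    and nowit: "\<And>z. (x, z) \<in> fst p \<Longrightarrow> (z, B) \<notin> snd p"
  shows "\<exists>q y. position q \<and> ext p q \<and> \<not> pprov H (seqn q) \<and> snd q \<inter> (lab p \<times> Sub) = snd p \<and>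
    y \<notin> lab p \<and> lab q = insert y (lab p) \<and> y \<in> cmp (fst q) x \<and>
    (\<forall>n. x \<in> cmp (fst p) n \<longrightarrow> y \<in> cmp (fst q) n)"
proof -
  let ?V = "lab p \<times> Sub"
  define P where "P = insert x {z. (z, x) \<in> fst p}"
  have fin: "finite (fst p)" "finite (snd p)" "finite ?V"
    using position_simps(1)[OF p] finite_snd[OF p] finite_vertices[OF p] by auto
  have "infinite ({y. tag y = Dia B} - lab p)"
    using infinite_tag[OF s(1)] finite_lab[OF p] by (simp add: Diff_infinite_finite)
  then obtain y where y: "tag y = Dia B" "y \<notin> lab p"
    using infinite_imp_nonempty by blast
  have Plab: "P \<subseteq> lab p" using x position_in_lab(1)[OF p] by (auto simp: P_def)
  have finP: "finite P" using Plab finite_lab[OF p] finite_subset by blast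
  have yF: "y \<notin> Field (fst p)" "y \<notin> fst ` snd p" "y \<notin> fst ` (?V - snd p)"
    using y(2) position_in_lab[OF p] position_simps(6)[OF p] by (auto simp: Field_def)
  have "\<not> pprov H (sseq (fst p \<union> P \<times> {y}) (insert (y, B) (snd p)) (?V - snd p))"
  proof
    assume "pprov H (sseq (fst p \<union> P \<times> {y}) (insert (y, B) (snd p)) (?V - snd p))"
    then have "pprov H (sseq (fst p \<union> {(x, y)} \<union> P \<times> {y}) (insert (y, B) (snd p)) (?V - snd p))"
      by (rule pprov_sseq_mono) (use fin finP in auto)
    then have "pprov H (sseq (fst p \<union> {(x, y)}) (insert (y, B) (snd p)) (?V - snd p))"
      by (rule pprov_tr[OF finP, of x, rotated]) (auto simp: P_def)
    then have "pprov H (sseq (fst p) (snd p) (?V - snd p))"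
      by (rule pprov_diaL) (use s fin yF in auto)
    then show False using u by (simp add: seqn_def)
  qed
  moreover have fin': "finite (insert y (lab p) \<times> Sub)" "finite (fst p \<union> P \<times> {y})"
    using finite_lab[OF p] finite_Sub fin finP by auto
  ultimately obtain G where G: "insert (y, B) (snd p) \<subseteq> G" "G \<subseteq> insert y (lab p) \<times> Sub"
      "G \<inter> (?V - snd p) = {}"
      "\<not> pprov H (sseq (fst p \<union> P \<times> {y}) G (insert y (lab p) \<times> Sub - G))"
    using completion[OF fin', of H "insert (y, B) (snd p)" "?V - snd p"]
      Sub_Dia[OF s(1)] position_simps(6)[OF p] by auto
  define q where "q = (fst p \<union> P \<times> {y}, G)"
  have tagy: "tag_ok G y" using y(1) s(1) G(1) by (auto simp: tag_ok_def)
  have sG: "snd p \<subseteq> G" using G(1) by simp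
  \<comment> \<open>A successor of \<open>x\<close> tagged \<open>Dia B\<close> would satisfy
    \<open>B\<close> by \<open>tag_ok\<close>, against \<open>nowit\<close>.\<close>
  have dia: "tag y \<noteq> Dia C" if xz: "(x, z) \<in> fst p" and tz: "tag z = Dia C" for z C
  proof
    assume "tag y = Dia C"
    then have C: "C = B" using y(1) by simp
    have "z \<in> Range (fst p)" using xz by blast
    then have "tag_ok (snd p) z" using p unfolding position_def by blast
    then have "(z, B) \<in> snd p" using tz C by (auto simp: tag_ok_def)
    then show False using nowit[OF xz] by simp
  qed
  have box: "\<forall>z\<in>P. \<forall>C. z \<in> Range (fst p) \<longrightarrow> tag z = Box C \<longrightarrow> tag y \<noteq> Box C"
    using y(1) by simp
  have dia': "\<forall>z C. (x, z) \<in> fst p \<longrightarrow> tag z = Dia C \<longrightarrow> tag y \<noteq> Dia C"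
    using dia by blast
  note q = add_label[OF p x y(2) P_def sG G(2) tagy box dia' q_def]
  have d: "is_dia (tag y)" using y(1) by (simp add: is_dia_def)
  have "\<not> pprov H (seqn q)" using G(4) by (simp add: seqn_def q(3)) (simp add: q_def)
  moreover have "snd q \<inter> ?V = snd p"
    using sG G(3) position_simps(6)[OF p] by (auto simp: q_def)
  ultimately show ?thesis
    using q(1-3) q(4)[OF d] q(5)[OF d] y(2) by blast
qed

text \<open>Koenig's lemma: the \<open>\<diamond>\<close>-children of a label have distinct tags, so an infinite component
  contains an infinite path.\<close>

lemma infinite_component_good:
  assumes p: "\<And>i. position (p i)" and e: "\<And>i. ext (p i) (p (Suc i))"
    and inf: "infinite (\<Union>i. cmp (fst (p i)) n)"
  shows "good (\<lambda>i. seqn (p i))"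
proof -
  have ext: "ext (p i) (p j)" if "i \<le> j" for i j
    using that by (induction j rule: dec_induct) (auto intro: ext_refl ext_trans e)
  define R where "R = (\<Union>i. fst (p i))"
  have sub: "fst (p i) \<subseteq> fst (p j)" if "i \<le> j" for i j
    using ext[OF that] by (simp add: ext_def)
  have fR: "(a, b) \<in> fst (p i) \<Longrightarrow> (a, b) \<in> R" for a b i
    by (auto simp: R_def)
  have Rp: "(a, b) \<in> fst (p i)" if ab: "(a, b) \<in> R" "b \<in> lab (p i)" for a b i
  proof -
    obtain j where "(a, b) \<in> fst (p j)" using ab(1) by (auto simp: R_def)
    then have "(a, b) \<in> fst (p (max i j))" using sub[of j "max i j"] by auto
    then show ?thesis using ext[of i "max i j"] ab(2) unfolding ext_def by auto
  qed
  have inlab: "a \<in> lab (p i) \<and> b \<in> lab (p i)" if "(a, b) \<in> fst (p i)" for a b i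
    using position_in_lab[OF p that] by simp
  have trR: "(a, c) \<in> R" if ab: "(a, b) \<in> R" and bc: "(b, c) \<in> R" for a b c
  proof -
    obtain i where i: "(b, c) \<in> fst (p i)" using bc by (auto simp: R_def)
    then have "(a, b) \<in> fst (p i)" using Rp[OF ab] inlab by blast
    then have "(a, c) \<in> fst (p i)" using i transD[OF position_simps(4)[OF p]] by blast
    then show ?thesis by (auto simp: R_def)
  qed
  have "\<exists>x. \<forall>k. (x k, x (Suc k)) \<in> R"
  proof (rule ccontr)
    assume no: "\<not> ?thesis"
    \<comment> \<open>Without an infinite path, induction from the leaves downwards shows that every
      component is finite.\<close>
    have wf: "wf (R\<inverse>)"
      unfolding wf_iff_no_infinite_down_chain using no by auto
    have "finite (cmp R a)" for a
      using wf
    proof (induction a rule: wf_induct_rule)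
      case (less a)
      define K where "K = {c. child R a c \<and> is_dia (tag c)}"
      have Ki: "child (fst (p i)) a c" if "child R a c" "c \<in> lab (p i)" for c i
      proof -
        have "(a, c) \<in> fst (p i)" using Rp that by (simp add: child_def)
        moreover have "(z, c) \<notin> fst (p i)" if "(a, z) \<in> fst (p i)" for z
          using \<open>child R a c\<close> fR[OF that] fR[of z c i] by (auto simp: child_def)
        ultimately show ?thesis by (simp add: child_def)
      qed
      have Kl: "\<exists>i. c \<in> lab (p i)" if "child R a c" for c
        using that inlab by (auto simp: child_def R_def)
      have tagK: "tag c \<in> Sub" if cK: "c \<in> K" for c
      proof -
        obtain i where "(a, c) \<in> fst (p i)" using cK by (auto simp: K_def child_def R_def)
        then have "tag_ok (snd (p i)) c" using p[of i] unfolding position_def by blast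
        then show ?thesis by (simp add: tag_ok_def)
      qed
      have "inj_on tag K"
      proof (rule inj_onI)
        fix c d assume cd: "c \<in> K" "d \<in> K" "tag c = tag d"
        then obtain B where B: "tag c = Dia B" "tag d = Dia B" by (auto simp: K_def is_dia_def)
        obtain i j where ij: "c \<in> lab (p i)" "d \<in> lab (p j)"
          using cd Kl unfolding K_def by blast
        define k where "k = max i j"
        have "c \<in> lab (p k)" "d \<in> lab (p k)"
          using ij lab_mono[OF ext[of i k]] lab_mono[OF ext[of j k]] by (auto simp: k_def)
        then have "child (fst (p k)) a c" "child (fst (p k)) a d"
          using Ki cd unfolding K_def by blast+
        then show "c = d" using p[of k] B unfolding position_def by blast
      qed
      then have finK: "finite K"
        by (rule inj_on_finite[of tag _ Sub]) (use tagK finite_Sub in auto)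
      \<comment> \<open>An element of the component is a diamond child of \<open>a\<close> or
        belongs to the component of one.\<close>
      have "cmp R a \<subseteq> (\<Union>c\<in>K. insert c (cmp R c))"
      proof
        fix y assume y: "y \<in> cmp R a"
        then have ay: "(a, y) \<in> R" by (simp add: cmp_def)
        obtain i where i: "(a, y) \<in> fst (p i)" using ay by (auto simp: R_def)
        define Z where "Z = {c. (a, c) \<in> R \<and> (c = y \<or> (c, y) \<in> R)}"
        have ylab: "y \<in> lab (p i)" using inlab[OF i] by simp
        have Zlab: "Z \<subseteq> lab (p i)"
        proof
          fix c assume "c \<in> Z"
          then have "c = y \<or> (c, y) \<in> fst (p i)" using Rp[OF _ ylab] by (auto simp: Z_def)
          then show "c \<in> lab (p i)" using inlab ylab by auto
        qed
        have "acyclic (fst (p i))"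
          using position_simps(4,5)[OF p[of i]] by (simp add: acyclic_irrefl trancl_id)
        then have wfi: "wf (fst (p i))"
          using position_simps(1)[OF p[of i]] by (simp add: finite_acyclic_wf)
        \<comment> \<open>A minimal element of \<open>Z\<close> is the first label above
          \<open>a\<close> on the way to \<open>y\<close>, hence a child of \<open>a\<close>. It
          exists because \<open>Z\<close> lies within the finite position
          \<open>p i\<close>.\<close>
        have "y \<in> Z" using ay by (simp add: Z_def)
        from wfE_min[OF wfi this]
        obtain c where cZ: "c \<in> Z" and cmin': "\<And>b. (b, c) \<in> fst (p i) \<Longrightarrow> b \<notin> Z"
          by metis
        have c: "(a, c) \<in> R" "c = y \<or> (c, y) \<in> R" using cZ by (auto simp: Z_def)
        have "c \<in> lab (p i)" using cZ Zlab by blast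
        then have cmin: "b \<notin> Z" if "(b, c) \<in> R" for b using Rp[OF that] cmin' by simp
        have "(z, c) \<notin> R" if az: "(a, z) \<in> R" for z
        proof
          assume zc: "(z, c) \<in> R"
          then have "(z, y) \<in> R" using c(2) trR by blast
          then show False using cmin[OF zc] az by (simp add: Z_def)
        qed
        then have "child R a c" using c(1) by (simp add: child_def)
        moreover have "is_dia (tag c)" using c y by (auto simp: cmp_def)
        ultimately have "c \<in> K" by (simp add: K_def)
        moreover have "y \<in> cmp R c" if "(c, y) \<in> R"
          using that y trR[OF c(1)] by (simp add: cmp_def)
        ultimately show "y \<in> (\<Union>c\<in>K. insert c (cmp R c))" using c(2) by blast
      qed
      moreover have "finite (cmp R c)" if "c \<in> K" for c
        using less that by (simp add: K_def child_def)
      ultimately show ?case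
        using finK by (auto intro: finite_subset)
    qed
    moreover have "(\<Union>i. cmp (fst (p i)) n) \<subseteq> cmp R n"
    proof
      fix y assume "y \<in> (\<Union>i. cmp (fst (p i)) n)"
      then obtain i where i: "y \<in> cmp (fst (p i)) n" by blast
      then have ny: "(n, y) \<in> fst (p i)" by (simp add: cmp_def)
      have "is_dia (tag z)" if z: "(n, z) \<in> R" "(z, y) \<in> R" for z
      proof -
        have zy: "(z, y) \<in> fst (p i)" using Rp[OF z(2)] inlab[OF ny] by simp
        then have "(n, z) \<in> fst (p i)" using Rp[OF z(1)] inlab[OF zy] by simp
        then show ?thesis using i zy by (simp add: cmp_def)
      qed
      then show "y \<in> cmp R n" using i ny by (auto simp: cmp_def R_def)
    qed
    ultimately show False using inf finite_subset by blast
  qed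
  then obtain x where x: "\<And>k. (x k, x (Suc k)) \<in> R" by blast
  then have "\<forall>k. \<exists>i. (x k, x (Suc k)) \<in> fst (p i)" by (auto simp: R_def)
  then obtain \<tau> where \<tau>: "\<And>k. (x k, x (Suc k)) \<in> fst (p (\<tau> k))" by metis
  \<comment> \<open>The times \<open>\<tau> k\<close> need not increase; their partial sums do, and
    they are late enough because edges persist.\<close>
  define t where "t k = (\<Sum>j\<le>k. Suc (\<tau> j))" for k
  have "strict_mono t" by (simp add: strict_mono_Suc_iff t_def)
  moreover have "\<tau> k \<le> t k" for k
    using member_le_sum[of k "{..k}" "\<lambda>j. Suc (\<tau> j)"] by (simp add: t_def)
  then have "(x k, x (Suc k)) \<in> fst (p (t k))" for k
    using \<tau>[of k] sub by blast
  ultimately show ?thesis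
    unfolding good_def by (intro exI[of _ x] exI[of _ t]) (simp add: seqn_def)
qed

section \<open>Ranks\<close>

definition grows :: "nat \<Rightarrow> 'p pos \<Rightarrow> 'p pos \<Rightarrow> bool" where
  "grows n p q \<longleftrightarrow> ext p q \<and> cmp (fst p) n \<subset> cmp (fst q) n"

text \<open>\<open>op F n Z\<close>: positions from which the component of \<open>n\<close> need not grow before \<open>Z\<close> is
  reached, while \<open>F\<close> is avoided.\<close>

definition op :: "'p pos set \<Rightarrow> nat \<Rightarrow> 'p pos set \<Rightarrow> 'p pos set" where
  "op F n Z = {p. position p \<and>
     \<not> pprov (seqn ` (F \<union> {q. position q \<and> q \<notin> Z \<and> grows n p q})) (seqn p)}"

lemma op_mono: "mono (op F n)"
proof (rule monoI)
  fix Z Z' :: "'p pos set" assume "Z \<subseteq> Z'"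
  then have sub: "seqn ` (F \<union> {q. position q \<and> q \<notin> Z' \<and> grows n p q})
      \<subseteq> seqn ` (F \<union> {q. position q \<and> q \<notin> Z \<and> grows n p q})" for p
    by (intro image_mono) blast
  show "op F n Z \<subseteq> op F n Z'"
    unfolding op_def using pprov_mono[OF _ sub] by (intro Collect_mono) blast
qed

lemma op_antimono:
  assumes "F \<subseteq> F'"
  shows "op F' n Z \<subseteq> op F n Z"
proof -
  have sub: "seqn ` (F \<union> {q. position q \<and> q \<notin> Z \<and> grows n p q})
      \<subseteq> seqn ` (F' \<union> {q. position q \<and> q \<notin> Z \<and> grows n p q})" for p
    using assms by (intro image_mono) blast
  show ?thesis
    unfolding op_def using pprov_mono[OF _ sub] by (intro Collect_mono) blast
qed

text \<open>A position outside the fixed point is provable from \<open>F\<close> and positions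
  outside it at which the component of \<open>n\<close> has grown. Along an infinite chain of these
  the component becomes infinite and carries a trace, so \<open>pprov_macro\<close> yields a proof
  from \<open>F\<close> alone.\<close>

lemma lfp_op:
  assumes p: "position p" and u: "\<not> pprov (seqn ` F) (seqn p)"
  shows "p \<in> lfp (op F n)"
proof (rule ccontr)
  assume np: "p \<notin> lfp (op F n)"
  define X where "X = {p. position p \<and> p \<notin> lfp (op F n)}"
  have "pprov (seqn ` F) (seqn p)"
  proof (rule pprov_macro[where X = X and N = "\<lambda>p. {q \<in> X. grows n p q}"])
    show "p \<in> X" using p np by (simp add: X_def)
  next
    fix r assume r: "r \<in> X"
    then have "r \<notin> op F n (lfp (op F n))"
      using lfp_unfold[OF op_mono] by (simp add: X_def)
    then have "pprov (seqn ` (F \<union> {q. position q \<and> q \<notin> lfp (op F n) \<and> grows n r q})) (seqn r)"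
      using r by (simp add: op_def X_def)
    moreover have "{q. position q \<and> q \<notin> lfp (op F n) \<and> grows n r q} = {q \<in> X. grows n r q}"
      by (auto simp: X_def)
    ultimately show "{q \<in> X. grows n r q} \<subseteq> X \<and>
        pprov (seqn ` F \<union> seqn ` {q \<in> X. grows n r q}) (seqn r)"
      by (simp add: image_Un)
  next
    fix f :: "nat \<Rightarrow> 'p pos"
    assume f: "\<And>i. f i \<in> X \<and> f (Suc i) \<in> {q \<in> X. grows n (f i) q}"
    have "infinite (\<Union>i. cmp (fst (f i)) n)"
      by (rule infinite_Union_strict_chain) (use f in \<open>simp add: grows_def\<close>)
    then show "good (\<lambda>i. seqn (f i))"
      by (intro infinite_component_good[of f n]) (use f in \<open>simp_all add: grows_def X_def\<close>)
  qed
  then show False using u by simp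
qed

definition rk :: "'p pos set \<Rightarrow> nat \<Rightarrow> 'p pos \<Rightarrow> 'p pos set" where
  "rk F n p = (SOME a. p \<in> stage (op F n) a \<and> (\<forall>b. (b, a) \<in> ord \<longrightarrow> p \<notin> stage (op F n) b))"

text \<open>The positions to be avoided from \<open>p\<close> on account of the components of \<open>0, \<dots>, n - 1\<close>.\<close>

primrec forb :: "nat \<Rightarrow> 'p pos \<Rightarrow> 'p pos set" where
  "forb 0 p = {}"
| "forb (Suc n) p = forb n p \<union>
     {q. position q \<and> q \<notin> below (op (forb n p) n) (rk (forb n p) n p) \<and> grows n p q}"

definition rank :: "nat \<Rightarrow> 'p pos \<Rightarrow> 'p pos set" where
  "rank n p = rk (forb n p) n p"

lemma rk:
  assumes "position p" "\<not> pprov (seqn ` F) (seqn p)"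
  shows "p \<in> stage (op F n) (rk F n p)"
    "p \<in> stage (op F n) b \<Longrightarrow> b = rk F n p \<or> (rk F n p, b) \<in> ord"
proof -
  obtain a where "p \<in> stage (op F n) a"
    using lfp_subset_stages[OF lfp_op[OF assms]] by blast
  then obtain a where "p \<in> stage (op F n) a \<and> (\<forall>b. (b, a) \<in> ord \<longrightarrow> p \<notin> stage (op F n) b)"
    using wfE_min[OF wf_ord, of a "{a. p \<in> stage (op F n) a}"] by (metis mem_Collect_eq)
  then have *: "p \<in> stage (op F n) (rk F n p) \<and> (\<forall>b. (b, rk F n p) \<in> ord \<longrightarrow> p \<notin> stage (op F n) b)"
    unfolding rk_def by (rule someI)
  then show "p \<in> stage (op F n) (rk F n p)" by simp
  show "b = rk F n p \<or> (rk F n p, b) \<in> ord" if "p \<in> stage (op F n) b"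
    using * that ord_total[of b "rk F n p"] by blast
qed

text \<open>Unfolding the stage given by the rank of \<open>p\<close>, membership of
  \<open>p\<close> in it says precisely that \<open>p\<close> is unprovable from
  \<open>forb (Suc n) p\<close>: growth of the component of \<open>n\<close> without a drop of rank
  relative to \<open>forb n p\<close> can be avoided.\<close>

lemma forb_unprov:
  assumes "position p" "\<not> pprov {} (seqn p)"
  shows "\<not> pprov (seqn ` forb n p) (seqn p)"
proof (induction n)
  case (Suc n)
  have "p \<in> op (forb n p) n (below (op (forb n p) n) (rk (forb n p) n p))"
    using rk(1)[OF assms(1) Suc, of n] by (simp add: stage_unfold)
  then show ?case by (simp add: op_def)
qed (use assms in simp)

section \<open>Lexicographic descent of ranks\<close>

definition agree :: "nat \<Rightarrow> 'p pos \<Rightarrow> 'p pos \<Rightarrow> bool" where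
  "agree j p q \<longleftrightarrow> rank j p = rank j q \<and> cmp (fst p) j = cmp (fst q) j"

definition drops :: "nat \<Rightarrow> 'p pos \<Rightarrow> 'p pos \<Rightarrow> bool" where
  "drops j p q \<longleftrightarrow> (\<forall>i<j. agree i p q) \<and> (rank j q, rank j p) \<in> ord"

definition desc :: "nat \<Rightarrow> 'p pos \<Rightarrow> 'p pos \<Rightarrow> bool" where
  "desc k p q \<longleftrightarrow> (\<exists>j<k. drops j p q) \<or> (\<forall>i<k. agree i p q)"

text \<open>Ranks at \<open>p\<close> and \<open>r\<close> refer to different forbidden sets, so the
  induction carries along \<open>forb k r \<subseteq> forb k p\<close>: fewer forbidden positions
  mean larger stages and no larger rank. If the component of \<open>k\<close> has grown, avoiding
  \<open>forb (Suc k) p\<close> forces a drop; if not, growth after \<open>r\<close> is growth after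
  \<open>p\<close>, and the rank drops or stays.\<close>

lemma desc_if_unprov:
  assumes p: "position p" "\<not> pprov {} (seqn p)" and r: "position r" and pr: "ext p r"
  shows "\<not> pprov (seqn ` forb k p) (seqn r) \<Longrightarrow>
    (\<exists>j<k. drops j p r) \<or> (\<forall>i<k. agree i p r) \<and> forb k r \<subseteq> forb k p"
proof (induction k)
  case (Suc k)
  define Fp where "Fp = forb k p"
  define Fr where "Fr = forb k r"
  define a where "a = rank k p"
  have fS: "forb (Suc k) p = Fp \<union> {q. position q \<and> q \<notin> below (op Fp k) a \<and> grows k p q}"
    by (simp add: Fp_def a_def rank_def)
  have "\<not> pprov (seqn ` forb k p) (seqn r)"
    using Suc.prems pprov_mono[OF _ image_mono[of "forb k p" "forb (Suc k) p" seqn], of "seqn r"]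
    by auto
  from Suc.IH[OF this] show ?case
  proof
    assume "\<exists>j<k. drops j p r"
    then show ?thesis by (auto intro: less_SucI)
  next
    assume ag: "(\<forall>i<k. agree i p r) \<and> forb k r \<subseteq> forb k p"
    then have sub: "Fr \<subseteq> Fp" by (simp add: Fr_def Fp_def)
    have bel: "below (op Fp k) b \<subseteq> below (op Fr k) b" for b
      by (rule below_mono[OF op_mono op_antimono[OF sub]])
    have "\<not> pprov (seqn ` Fr) (seqn r)"
      using Suc.prems pprov_mono[OF _ image_mono[of Fr "forb (Suc k) p" seqn], of "seqn r"] sub
      unfolding fS by auto
    note rkr = rk(2)[OF r this, of k, folded rank_def[of k r, folded Fr_def]]
    show ?thesis
    proof (cases "cmp (fst p) k = cmp (fst r) k")
      case False
      then have g: "grows k p r" using pr cmp_mono[OF p(1) pr, of k] by (auto simp: grows_def)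
      have "r \<notin> forb (Suc k) p"
        using Suc.prems pprov_hyp[of "seqn r" "seqn ` forb (Suc k) p"] position_simps(1)[OF r]
        by (auto simp: seqn_def)
      then have "r \<in> below (op Fr k) a" using g r bel[of a] unfolding fS by blast
      then obtain b where b: "(b, a) \<in> ord" "r \<in> stage (op Fr k) b"
        by (auto simp: below_def)
      have "(rank k r, a) \<in> ord" using rkr[OF b(2)] b(1) ord_trans by blast
      then have "drops k p r" using ag by (simp add: drops_def a_def)
      then show ?thesis by blast
    next
      case True
      have g: "grows k r q \<Longrightarrow> grows k p q" for q
        using True ext_trans[OF pr] by (simp add: grows_def)
      have sub2: "Fr \<union> {q. position q \<and> q \<notin> below (op Fr k) a \<and> grows k r q} \<subseteq> forb (Suc k) p"
        unfolding fS using sub bel[of a] g by blast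
      have "\<not> pprov (seqn ` (Fr \<union> {q. position q \<and> q \<notin> below (op Fr k) a \<and> grows k r q})) (seqn r)"
        using Suc.prems pprov_mono[OF _ image_mono[OF sub2]] by blast
      then have "r \<in> stage (op Fr k) a" using r by (simp add: stage_unfold op_def)
      from rkr[OF this] show ?thesis
      proof
        assume eq: "a = rank k r"
        then have "agree k p r" using True by (simp add: agree_def a_def)
        then have "\<forall>i<Suc k. agree i p r" using ag less_Suc_eq by auto
        moreover have "forb (Suc k) r \<subseteq> forb (Suc k) p"
          using sub2 eq by (simp add: Fr_def rank_def)
        ultimately show ?thesis by blast
      next
        assume "(rank k r, a) \<in> ord"
        then have "drops k p r" using ag by (simp add: drops_def a_def)
        then show ?thesis by blast
      qed
    qed
  qed
qed simp

text \<open>A drop at or beyond \<open>l\<close> includes agreement everywhere below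
  \<open>l\<close>.\<close>

lemma desc_mono: "desc k p q \<Longrightarrow> l \<le> k \<Longrightarrow> desc l p q"
proof -
  assume d: "desc k p q" and l: "l \<le> k"
  show "desc l p q"
  proof (cases "\<exists>j<l. drops j p q")
    case False
    have "agree i p q" if "i < l" for i
      using d
      unfolding desc_def
    proof
      assume "\<exists>j<k. drops j p q"
      then obtain j where "drops j p q" by blast
      moreover have "l \<le> j" using False calculation not_less by blast
      ultimately show ?thesis using that by (simp add: drops_def)
    qed (use that l in simp)
    then show ?thesis by (simp add: desc_def)
  qed (simp add: desc_def)
qed

lemma agree_trans: "agree j p q \<Longrightarrow> agree j q r \<Longrightarrow> agree j p r"
  by (simp add: agree_def)

lemma desc_trans:
  assumes "desc k p q" "desc k q r"
  shows "desc k p r"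
proof -
  have 1: "drops i p r" if "drops i p q" "\<forall>i'<j. agree i' q r" "i < j" for i j
    using that by (auto simp: drops_def agree_def)
  have 2: "drops i p r" if "drops i q r" "\<forall>i'<j. agree i' p q" "i < j" for i j
    using that by (auto simp: drops_def agree_def)
  have 3: "drops i p r" if "drops i p q" "drops i q r" for i
    using that agree_trans[of _ p q r] ord_trans unfolding drops_def by blast
  have 4: "\<exists>l<k. drops l p r" if i: "drops i p q" "i < k" and j: "drops j q r" "j < k" for i j
  proof (cases i j rule: linorder_cases)
    case less
    then have "drops i p r" using 1[OF i(1), of j] j(1) by (simp add: drops_def)
    then show ?thesis using i(2) by blast
  next
    case equal
    then show ?thesis using 3 i j by blast
  next
    case greater
    then have "drops j p r" using 2[OF j(1), of i] i(1) by (simp add: drops_def)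
    then show ?thesis using j(2) by blast
  qed
  from assms(1) show ?thesis
    unfolding desc_def[of k p q]
  proof
    assume "\<exists>j<k. drops j p q"
    then obtain i where i: "i < k" "drops i p q" by blast
    from assms(2) show ?thesis
      unfolding desc_def[of k q r]
    proof
      assume "\<exists>j<k. drops j q r"
      then show ?thesis using 4 i by (auto simp: desc_def)
    next
      assume "\<forall>i<k. agree i q r"
      then show ?thesis using 1[of i k] i by (auto simp: desc_def)
    qed
  next
    assume pq: "\<forall>i<k. agree i p q"
    from assms(2) show ?thesis
      unfolding desc_def[of k q r]
    proof
      assume "\<exists>j<k. drops j q r"
      then show ?thesis using 2[OF _ pq] by (auto simp: desc_def)
    next
      assume "\<forall>i<k. agree i q r"
      then show ?thesis using pq by (simp add: desc_def agree_def)
    qed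
  qed
qed

text \<open>The number of labels serves as the bound since it cannot decrease along
  \<open>ext\<close>, which transitivity requires, and it is unbounded whenever labels are added
  forever.\<close>

definition acc :: "'p pos \<Rightarrow> 'p pos \<Rightarrow> bool" where
  "acc p q \<longleftrightarrow> ext p q \<and> desc (card (lab p)) p q"

lemma acc_refl: "acc p p"
  by (simp add: acc_def ext_refl desc_def agree_def)

lemma acc_trans:
  assumes "acc p q" "acc q r" "position q"
  shows "acc p r"
proof -
  have "card (lab p) \<le> card (lab q)"
    using assms by (intro card_mono finite_lab lab_mono) (auto simp: acc_def)
  then show ?thesis
    using assms ext_trans[of p q r] desc_trans desc_mono unfolding acc_def by blast
qed

lemma acc_if_unprov:
  assumes "position p" "\<not> pprov {} (seqn p)" "position r" "ext p r"
    "\<not> pprov (seqn ` forb (card (lab p)) p) (seqn r)"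
  shows "acc p r"
  using desc_if_unprov[OF assms] assms(4) by (auto simp: acc_def desc_def)

text \<open>By induction on \<open>n\<close>, ranks and components of the labels below
  \<open>n\<close> become constant. Once this has happened and the bound exceeds \<open>n\<close>,
  each step either drops the rank of \<open>n\<close>, which well-foundedness stops, or leaves rank
  and component as they are.\<close>

lemma finite_component:
  assumes p: "\<And>i::nat. position (p i)" and a: "\<And>i. acc (p i) (p (Suc i))"
    and unb: "\<And>k. \<exists>i. k \<le> card (lab (p i))"
  shows "finite (\<Union>i. cmp (fst (p i)) n)"
proof -
  have ext: "ext (p i) (p j)" if "i \<le> j" for i j
    using that by (induction j rule: dec_induct) (use a ext_refl ext_trans acc_def in blast)+
  have "\<exists>N. \<forall>i\<ge>N. \<forall>j<n. agree j (p N) (p i)" for n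
  proof (induction n)
    case (Suc n)
    then obtain N where N: "\<And>i j. i \<ge> N \<Longrightarrow> j < n \<Longrightarrow> agree j (p N) (p i)" by blast
    obtain M where M: "Suc n \<le> card (lab (p M))" using unb by blast
    \<comment> \<open>From \<open>N'\<close> on, the components before \<open>n\<close> are settled
      and \<open>n\<close> itself is among those compared.\<close>
    define N' where "N' = max N M"
    have big: "Suc n \<le> card (lab (p i))" if "i \<ge> N'" for i
    proof -
      have "card (lab (p M)) \<le> card (lab (p i))"
        using that by (intro card_mono finite_lab p lab_mono ext) (simp add: N'_def)
      then show ?thesis using M by simp
    qed
    have step0: "agree n (p i) (p (Suc i)) \<or> (rank n (p (Suc i)), rank n (p i)) \<in> ord" if "i \<ge> N'" for i
    proof -
      have ag: "agree j (p i) (p (Suc i))" if "j < n" for j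
        using N[of i j] N[of "Suc i" j] that \<open>i \<ge> N'\<close> by (simp add: agree_def N'_def)
      have "desc (Suc n) (p i) (p (Suc i))"
        using a[of i] big[OF that] desc_mono unfolding acc_def by blast
      then show ?thesis
        unfolding desc_def
      proof
        assume "\<exists>j<Suc n. drops j (p i) (p (Suc i))"
        then obtain j where j: "j < Suc n" "drops j (p i) (p (Suc i))" by blast
        have "\<not> j < n"
          using ag[of j] j(2) ord_irrefl[of "rank j (p i)"] by (auto simp: drops_def agree_def)
        then show ?thesis using j by (simp add: drops_def less_Suc_eq)
      qed simp
    qed
    obtain m where m: "m \<in> (\<lambda>i. rank n (p i)) ` {N'..}"
        "\<And>b. (b, m) \<in> ord \<Longrightarrow> b \<notin> (\<lambda>i. rank n (p i)) ` {N'..}"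
      using wfE_min[OF wf_ord, of "rank n (p N')" "(\<lambda>i. rank n (p i)) ` {N'..}"] by blast
    then obtain K where K: "K \<ge> N'" "m = rank n (p K)" by auto
    have "agree n (p K) (p i)" if "i \<ge> K" for i
      using that
    proof (induction i rule: dec_induct)
      case base
      then show ?case by (simp add: agree_def)
    next
      case (step i)
      have "rank n (p i) = m" using step.IH K by (simp add: agree_def)
      moreover have "rank n (p (Suc i)) \<in> (\<lambda>i. rank n (p i)) ` {N'..}"
        using step.hyps(1) K(1) by (intro imageI) simp
      ultimately have "agree n (p i) (p (Suc i))"
        using step0[of i] m(2) step.hyps(1) K(1) by force
      then show ?case using step.IH agree_trans by blast
    qed
    moreover have "agree j (p K) (p i)" if "i \<ge> K" "j < n" for i j
      using N[of K j] N[of i j] that K by (simp add: agree_def N'_def)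
    ultimately show ?case by (intro exI[of _ K]) (auto simp: less_Suc_eq)
  qed simp
  then obtain N where N: "\<And>i. i \<ge> N \<Longrightarrow> agree n (p N) (p i)" by (meson lessI)
  have "cmp (fst (p i)) n \<subseteq> cmp (fst (p N)) n" for i
  proof (cases "i \<ge> N")
    case True
    then show ?thesis using N by (simp add: agree_def)
  next
    case False
    then show ?thesis by (intro cmp_mono p ext) simp
  qed
  moreover have "cmp (fst (p N)) n \<subseteq> lab (p N)"
    using position_in_lab(2)[OF p[of N]] by (auto simp: cmp_def)
  ultimately have "(\<Union>i. cmp (fst (p i)) n) \<subseteq> lab (p N)"
    by blast
  then show ?thesis using finite_lab[OF p] finite_subset by blast
qed

section \<open>The countermodel\<close>

text \<open>Among the truth conditions that stay inside one world, only witnesses for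
  \<open>Dia\<close> do not follow from unprovability.\<close>

definition world :: "'p pos \<Rightarrow> bool" where
  "world p \<longleftrightarrow> position p \<and> \<not> pprov {} (seqn p) \<and>
     (\<forall>x B. (x, Dia B) \<in> snd p \<longrightarrow> (\<exists>z. (x, z) \<in> fst p \<and> (z, B) \<in> snd p))"

lemma unprov_forb:
  assumes "position p" "\<not> pprov {} (seqn p)" "position q" "ext p q"
    "\<not> pprov (seqn ` forb (card (lab p)) p) (seqn q)"
  shows "acc p q" "\<not> pprov {} (seqn q)"
  using acc_if_unprov[OF assms] assms(5) pprov_mono[of "{}" "seqn q"] by auto

text \<open>Otherwise witnesses could be added forever. Each new label lies in the component of some
  label of \<open>p\<close>; these finitely many components stay finite along the chain, while the
  number of labels increases at every step.\<close>

lemma saturate: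
  assumes p: "position p" and u: "\<not> pprov {} (seqn p)"
  shows "\<exists>q. world q \<and> acc p q \<and> snd q \<inter> (lab p \<times> Sub) = snd p"
proof (rule ccontr)
  assume no: "\<not> ?thesis"
  define X where "X = {q. position q \<and> \<not> pprov {} (seqn q) \<and> acc p q \<and> snd q \<inter> (lab p \<times> Sub) = snd p}"
  define step where "step q q' \<longleftrightarrow> acc q q' \<and> (\<exists>x y. x \<in> lab q \<and> y \<notin> lab q \<and>
      lab q' = insert y (lab q) \<and> y \<in> cmp (fst q') x \<and>
      (\<forall>n. x \<in> cmp (fst q) n \<longrightarrow> y \<in> cmp (fst q') n))" for q q'
  have "\<exists>q'. q' \<in> X \<and> step q q'" if q: "q \<in> X" for q
  proof -
    have pq: "position q" "\<not> pprov {} (seqn q)" "acc p q" "snd q \<inter> (lab p \<times> Sub) = snd p"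
      using q by (simp_all add: X_def)
    have "\<not> world q" using no pq by blast
    then obtain x B where xB: "(x, Dia B) \<in> snd q" "\<And>z. (x, z) \<in> fst q \<Longrightarrow> (z, B) \<notin> snd q"
      using pq(1,2) unfolding world_def by blast
    have xl: "x \<in> lab q" "Dia B \<in> Sub" using xB(1) position_simps(6)[OF pq(1)] by auto
    obtain q' y where q': "position q'" "ext q q'"
        "\<not> pprov (seqn ` forb (card (lab q)) q) (seqn q')"
        "snd q' \<inter> (lab q \<times> Sub) = snd q"
        "y \<notin> lab q" "lab q' = insert y (lab q)" "y \<in> cmp (fst q') x"
        "\<forall>n. x \<in> cmp (fst q) n \<longrightarrow> y \<in> cmp (fst q') n"
      using answer_Dia[OF pq(1) forb_unprov[OF pq(1,2)] xl xB] by blast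
    note aq = unprov_forb[OF pq(1,2) q'(1,2,3)]
    have "lab p \<times> Sub \<subseteq> lab q \<times> Sub" using lab_mono[of p q] pq(3) by (auto simp: acc_def)
    then have "snd q' \<inter> (lab p \<times> Sub) = snd p" using q'(4) pq(4) by blast
    moreover have "acc p q'" by (rule acc_trans[OF pq(3) aq(1) pq(1)])
    ultimately have "q' \<in> X" using q'(1) aq(2) by (simp add: X_def)
    moreover have "step q q'" unfolding step_def using aq(1) xl(1) q' by blast
    ultimately show ?thesis by blast
  qed
  then obtain g where g: "\<And>q. q \<in> X \<Longrightarrow> g q \<in> X \<and> step q (g q)" by metis
  define f where "f i = (g ^^ i) p" for i
  have fX: "f i \<in> X" for i
    by (induction i) (use p u acc_refl g position_simps(6)[OF p] in \<open>auto simp: f_def X_def\<close>)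
  have fs: "step (f i) (f (Suc i))" for i using g[OF fX[of i]] by (simp add: f_def)
  have pos: "position (f i)" for i using fX by (simp add: X_def)
  have ac: "acc (f i) (f (Suc i))" for i using fs by (simp add: step_def)
  have card: "card (lab (f i)) \<ge> i" for i
  proof (induction i)
    case (Suc i)
    have "card (lab (f (Suc i))) = Suc (card (lab (f i)))"
      using fs[of i] finite_lab[OF pos[of i]] by (auto simp: step_def)
    then show ?case using Suc by simp
  qed simp
  define U where "U = lab p \<union> (\<Union>n\<in>lab p. \<Union>i. cmp (fst (f i)) n)"
  have finU: "finite U"
    unfolding U_def using finite_lab[OF p] finite_component[of f, OF pos ac] card by blast
  have "lab (f i) \<subseteq> lab p \<union> (\<Union>n\<in>lab p. cmp (fst (f i)) n)" for i
  proof (induction i)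
    case 0
    then show ?case by (simp add: f_def)
  next
    case (Suc i)
    obtain x y where xy: "x \<in> lab (f i)" "lab (f (Suc i)) = insert y (lab (f i))"
        "y \<in> cmp (fst (f (Suc i))) x" "\<And>n. x \<in> cmp (fst (f i)) n \<Longrightarrow> y \<in> cmp (fst (f (Suc i))) n"
      using fs[of i] unfolding step_def by blast
    have "x \<in> lab p \<or> (\<exists>n\<in>lab p. x \<in> cmp (fst (f i)) n)"
      using xy(1) Suc by auto
    then have y: "y \<in> (\<Union>n\<in>lab p. cmp (fst (f (Suc i))) n)"
      using xy(3,4) by auto
    have "cmp (fst (f i)) n \<subseteq> cmp (fst (f (Suc i))) n" for n
      by (rule cmp_mono[OF pos]) (use ac in \<open>simp add: acc_def\<close>)
    then have "(\<Union>n\<in>lab p. cmp (fst (f i)) n) \<subseteq> (\<Union>n\<in>lab p. cmp (fst (f (Suc i))) n)"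
      by (intro UN_mono) auto
    then have "lab (f i) \<subseteq> lab p \<union> (\<Union>n\<in>lab p. cmp (fst (f (Suc i))) n)"
      by (rule order_trans[OF Suc Un_mono[OF subset_refl]])
    then show ?case using y unfolding xy(2) by simp
  qed
  moreover have "lab p \<union> (\<Union>n\<in>lab p. cmp (fst (f i)) n) \<subseteq> U" for i
    unfolding U_def by (intro Un_mono UN_mono) auto
  ultimately have "lab (f i) \<subseteq> U" for i by (rule order_trans)
  then have "card (lab (f i)) \<le> card U" for i by (rule card_mono[OF finU])
  from order_trans[OF card[of "Suc (card U)"] this] show False by simp
qed

text \<open>The answer is saturated afterwards; as this keeps all truth values at its labels,
  \<open>B\<close> remains true and \<open>C\<close> false at \<open>x\<close>.\<close>

lemma world_Imp:
  assumes p: "world p" and x: "x \<in> lab p" and s: "Imp B C \<in> Sub" "(x, Imp B C) \<notin> snd p"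
  shows "\<exists>q. world q \<and> acc p q \<and> (x, B) \<in> snd q \<and> (x, C) \<notin> snd q"
proof -
  have pp: "position p" "\<not> pprov {} (seqn p)" using p by (simp_all add: world_def)
  obtain q where q: "position q" "ext p q" "\<not> pprov (seqn ` forb (card (lab p)) p) (seqn q)"
      "(x, B) \<in> snd q" "(x, C) \<notin> snd q"
    using answer_Imp[OF pp(1) forb_unprov[OF pp] x s] by blast
  note aq = unprov_forb[OF pp q(1,2,3)]
  obtain r where r: "world r" "acc q r" "snd r \<inter> (lab q \<times> Sub) = snd q"
    using saturate[OF q(1) aq(2)] by blast
  have "(x, C) \<in> lab q \<times> Sub" using x lab_mono[OF q(2)] Sub_Imp[OF s(1)] by auto
  then have "(x, B) \<in> snd r" "(x, C) \<notin> snd r" using r(3) q(4,5) by blast+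
  then show ?thesis using r(1) acc_trans[OF aq(1) r(2) q(1)] by blast
qed

lemma world_Box:
  assumes p: "world p" and x: "x \<in> lab p" and s: "Box B \<in> Sub" "(x, Box B) \<notin> snd p"
  shows "\<exists>q y. world q \<and> acc p q \<and> y \<in> lab q \<and> (x, y) \<in> fst q \<and> (y, B) \<notin> snd q"
proof -
  have pp: "position p" "\<not> pprov {} (seqn p)" using p by (simp_all add: world_def)
  obtain q y where q: "position q" "ext p q" "\<not> pprov (seqn ` forb (card (lab p)) p) (seqn q)"
      "y \<in> lab q" "(x, y) \<in> fst q" "(y, B) \<notin> snd q"
    using answer_Box[OF pp(1) forb_unprov[OF pp] x s] by blast
  note aq = unprov_forb[OF pp q(1,2,3)]
  obtain r where r: "world r" "acc q r" "snd r \<inter> (lab q \<times> Sub) = snd q"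
    using saturate[OF q(1) aq(2)] by blast
  have "(y, B) \<in> lab q \<times> Sub" using q(4) Sub_Box[OF s(1)] by auto
  then have "(y, B) \<notin> snd r" using r(3) q(6) by blast
  moreover have "y \<in> lab r" "(x, y) \<in> fst r"
    using r(2) q(4,5) lab_mono[of q r] by (auto simp: acc_def ext_def)
  ultimately show ?thesis using r(1) acc_trans[OF aq(1) r(2) q(1)] by blast
qed

text \<open>Box tags do not repeat along a path, so finitely many box labels precede its members,
  all of them below some \<open>d M\<close>. From there the path runs inside the component of
  \<open>d M\<close>, against \<open>finite_component\<close>.\<close>

lemma no_infinite_path:
  assumes pos: "\<And>i::nat. position (p i)" and ac: "\<And>i. acc (p i) (p (Suc i))"
    and d: "\<And>i. (d i, d (Suc i)) \<in> fst (p (Suc i))"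
  shows False
proof -
  have ext: "ext (p i) (p j)" if "i \<le> j" for i j
    using that by (induction j rule: dec_induct) (use ac ext_refl ext_trans acc_def in blast)+
  have sub: "e \<in> fst (p i) \<Longrightarrow> i \<le> j \<Longrightarrow> e \<in> fst (p j)" for e i j
    using ext[of i j] by (auto simp: ext_def)
  have tr: "(a, b) \<in> fst (p i) \<Longrightarrow> (b, c) \<in> fst (p i) \<Longrightarrow> (a, c) \<in> fst (p i)" for a b c i
    using transD[OF position_simps(4)[OF pos]] by blast
  have irr: "(a, a) \<notin> fst (p i)" for a i
    using position_simps(5)[OF pos[of i]] by (simp add: irrefl_def)
  have dd: "(d i, d j) \<in> fst (p j)" if "i < j" for i j
    using that
  proof (induction j)
    case (Suc j)
    show ?case
    proof (cases "i = j")
      case False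
      then have "(d i, d j) \<in> fst (p (Suc j))" using Suc sub[of _ j "Suc j"] by simp
      then show ?thesis using tr d by blast
    qed (use d in simp)
  qed simp
  have dinj: "inj d"
  proof (rule linorder_injI)
    fix i j :: nat assume "i < j"
    then show "d i \<noteq> d j" using dd irr by metis
  qed
  have "j \<le> card (lab (p j))" for j
  proof -
    have "d ` {..<j} \<subseteq> lab (p j)" using dd position_in_lab(1)[OF pos] by blast
    then have "card (d ` {..<j}) \<le> card (lab (p j))" by (rule card_mono[OF finite_lab[OF pos]])
    moreover have "card (d ` {..<j}) = j" using dinj by (simp add: card_image inj_on_subset)
    ultimately show ?thesis by simp
  qed
  then have fc: "finite (\<Union>i. cmp (fst (p i)) n)" for n
    by (intro finite_component pos ac) blast
  \<comment> \<open>By transitivity the path may skip labels of the tree, so \<open>C\<close> also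
    collects labels between its members. The range condition excludes the root, whose tag carries no
    information.\<close>
  define C where "C = {z. \<not> is_dia (tag z) \<and> (\<exists>j. (z, d j) \<in> fst (p j) \<and> z \<in> Range (fst (p j)))}"
  have Ctag: "\<exists>B. tag z = Box B \<and> tag z \<in> Sub" if z: "z \<in> C" for z
  proof -
    obtain j where "z \<in> Range (fst (p j))" "\<not> is_dia (tag z)" using z by (auto simp: C_def)
    moreover from this have "tag_ok (snd (p j)) z" using pos[of j] unfolding position_def by blast
    ultimately show ?thesis by (auto simp: tag_ok_def is_dia_def)
  qed
  have "inj_on tag C"
  proof (rule inj_onI)
    fix z z' assume zz: "z \<in> C" "z' \<in> C" "tag z = tag z'"
    obtain B where B: "tag z = Box B" "tag z' = Box B" using Ctag[OF zz(1)] zz(3) by auto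
    obtain i j where i: "(z, d i) \<in> fst (p i)" "z \<in> Range (fst (p i))"
      and j: "(z', d j) \<in> fst (p j)" "z' \<in> Range (fst (p j))"
      using zz(1,2) by (auto simp: C_def)
    define k where "k = Suc (max i j)"
    have ik: "i < k" "j < k" "i \<le> k" "j \<le> k" by (auto simp: k_def)
    have m: "(z, d k) \<in> fst (p k)" "(z', d k) \<in> fst (p k)"
      using tr[OF sub[OF i(1) ik(3)] dd[OF ik(1)]] tr[OF sub[OF j(1) ik(4)] dd[OF ik(2)]] by auto
    have rg: "z \<in> Range (fst (p k))" "z' \<in> Range (fst (p k))"
      using i(2) j(2) sub ik by blast+
    have "z = z' \<or> (z, z') \<in> fst (p k) \<or> (z', z) \<in> fst (p k)"
      using m pos[of k] unfolding position_def by blast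
    moreover have "\<not> (a, b) \<in> fst (p k)" if "a \<in> Range (fst (p k))" "tag a = Box B" "tag b = Box B" for a b
      using that pos[of k] unfolding position_def by blast
    ultimately show "z = z'" using rg B by blast
  qed
  then have finC: "finite C"
    by (rule inj_on_finite[of tag _ Sub]) (use Ctag finite_Sub in auto)
  have "\<forall>z\<in>C. \<exists>j. (z, d j) \<in> fst (p j)" by (auto simp: C_def)
  then obtain g where g: "\<And>z. z \<in> C \<Longrightarrow> (z, d (g z)) \<in> fst (p (g z))" by metis
  obtain M where M: "\<And>z. z \<in> C \<Longrightarrow> g z \<le> M"
    using finC by (metis finite_imageI finite_nat_set_iff_bounded_le imageI)
  have CM: "(z, d M) \<in> fst (p M)" if z: "z \<in> C" for z
  proof (cases "g z = M")
    case False
    then have "g z < M" using M[OF z] by simp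
    then show ?thesis using tr[OF sub[OF g[OF z]] dd] by simp
  qed (use g[OF z] in simp)
  have notC: "z \<notin> C" if z: "(d M, z) \<in> fst (p j)" "M \<le> j" for z j
  proof
    assume "z \<in> C"
    then have "(z, d M) \<in> fst (p j)" using CM sub z(2) by blast
    then show False using tr[OF z(1)] irr by blast
  qed
  have "d j \<in> cmp (fst (p j)) (d M)" if j: "M < j" for j
  proof -
    have "(d j, d (Suc j)) \<in> fst (p (Suc j))" "d j \<in> Range (fst (p (Suc j)))"
      using d sub[OF dd[OF j], of "Suc j"] by auto
    then have "is_dia (tag (d j))"
      using notC[OF dd[OF j]] j unfolding C_def by auto
    moreover have "is_dia (tag z)" if z: "(d M, z) \<in> fst (p j)" "(z, d j) \<in> fst (p j)" for z
    proof -
      have "z \<in> Range (fst (p j))" using z(1) by blast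
      then show ?thesis using notC[OF z(1)] j z(2) unfolding C_def by auto
    qed
    ultimately show ?thesis using dd[OF j] by (simp add: cmp_def)
  qed
  then have "d ` {M<..} \<subseteq> (\<Union>i. cmp (fst (p i)) (d M))" by blast
  then have "finite (d ` {M<..})" using fc finite_subset by blast
  then have "finite {M<..}" using dinj finite_imageD inj_on_subset by blast
  then show False by (simp add: infinite_Ioi)
qed

text \<open>Validity quantifies over structures on the natural numbers. Labels are numbers already;
  worlds have to be coded.\<close>

lemma countable_worlds: "countable (Collect world)"
proof -
  have "countable {R :: (label \<times> label) set. finite R}"
    using countable_Collect_finite by simp
  moreover have "countable {G. G \<subseteq> (UNIV :: label set) \<times> Sub \<and> finite G}"
    using countable_Collect_finite_subset[of "(UNIV :: label set) \<times> Sub"] finite_Sub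
    by (simp add: countable_finite conj_commute)
  ultimately have "countable ({R :: (label \<times> label) set. finite R} \<times> {G. G \<subseteq> (UNIV :: label set) \<times> Sub \<and> finite G})"
    by (intro countable_SIGMA)
  then show ?thesis
  proof (rule countable_subset[rotated], intro subsetI)
    fix p assume "p \<in> Collect world"
    then have "position p" by (simp add: world_def)
    then show "p \<in> {R. finite R} \<times> {G. G \<subseteq> UNIV \<times> Sub \<and> finite G}"
      using position_simps(1,6)[of p] finite_snd[of p] by (cases p) auto
  qed
qed

abbreviation code :: "'p pos \<Rightarrow> nat" where
  "code \<equiv> to_nat_on (Collect world)"

abbreviation decode :: "nat \<Rightarrow> 'p pos" where
  "decode \<equiv> from_nat_into (Collect world)"

definition model :: "(nat, nat, 'p) kstruct" where
  "model = \<lparr>W = code ` Collect world, le = (\<lambda>a b. acc (decode a) (decode b)),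
     D = (\<lambda>a. lab (decode a)), Pr = (\<lambda>a P. {x. (x, Atom P) \<in> snd (decode a)}),
     Rl = (\<lambda>a. fst (decode a))\<rparr>"

lemma decode_code: "world p \<Longrightarrow> decode (code p) = p"
  using countable_worlds by simp

lemma PIGL_model: "PIGL_struct model"
proof -
  have dw: "world (decode a) \<and> code (decode a) = a" if "a \<in> W model" for a
    using that decode_code by (auto simp: model_def)
  have dp: "position (decode a)" if "a \<in> W model" for a using dw[OF that] by (simp add: world_def)
  have "kripke model"
    unfolding kripke_def
  proof (intro conjI ballI impI allI)
    fix u v w assume "u \<in> W model" "v \<in> W model" "w \<in> W model" "le model u v" "le model v w"
    then show "le model u w" using acc_trans dp by (simp add: model_def)
  next
    fix u v assume uv: "u \<in> W model" "v \<in> W model" "le model u v" "le model v u"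
    then have "decode u = decode v" using ext_antisym by (auto simp: model_def acc_def)
    then show "u = v" using dw uv(1,2) by metis
  next
    fix w p assume "w \<in> W model"
    then show "Pr model w p \<subseteq> D model w"
      using position_simps(6)[OF dp] by (auto simp: model_def)
  next
    fix w assume "w \<in> W model"
    then show "Rl model w \<subseteq> D model w \<times> D model w"
      using position_in_lab[OF dp] by (auto simp: model_def)
  next
    fix u v assume "le model u v"
    then have "ext (decode u) (decode v)" by (simp add: model_def acc_def)
    then show "D model u \<subseteq> D model v" "Rl model u \<subseteq> Rl model v" "Pr model u p \<subseteq> Pr model v p" for p
      using lab_mono by (auto simp: model_def ext_def)
  qed (simp_all add: model_def acc_refl lab_def)
  moreover have "\<forall>w\<in>W model. trans (Rl model w)"
    using position_simps(4)[OF dp] by (simp add: model_def)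
  moreover have False
    if ws: "\<forall>i. ws i \<in> W model \<and> ds i \<in> D model (ws i)"
      and st: "\<forall>i. le model (ws i) (ws (Suc i)) \<and> ds i \<in> D model (ws (Suc i)) \<and>
                    (ds i, ds (Suc i)) \<in> Rl model (ws (Suc i))" for ws ds
    by (rule no_infinite_path[of "\<lambda>i. decode (ws i)" ds]) (use dp ws st in \<open>auto simp: model_def\<close>)
  ultimately show ?thesis unfolding PIGL_struct_def by blast
qed

text \<open>For implications and boxes, refuted formulas get their counterexample from
  \<open>world_Imp\<close> and \<open>world_Box\<close>, and true ones persist along
  \<open>acc\<close>, where the local conditions apply. Diamonds are settled in the world
  itself.\<close>

lemma truth:
  "C \<in> Sub \<Longrightarrow> world p \<Longrightarrow> x \<in> lab p \<Longrightarrow> forces model (code p) x C \<longleftrightarrow> (x, C) \<in> snd p"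
proof (induction C arbitrary: p x)
  case (Atom P)
  then show ?case by (simp add: model_def decode_code)
next
  case Bot
  then show ?case using local_Bot[of p "{}" x] by (simp add: world_def)
next
  case (And B C)
  then show ?case using local_And[of p "{}" x B C] Sub_And[of B C] by (simp add: world_def)
next
  case (Or B C)
  then show ?case using local_Or[of p "{}" x B C] Sub_Or[of B C] by (simp add: world_def)
next
  case (Imp B C)
  have s: "B \<in> Sub" "C \<in> Sub" using Sub_Imp[OF Imp.prems(1)] by auto
  have "forces model (code p) x (Imp B C) \<longleftrightarrow>
      (\<forall>q. world q \<longrightarrow> acc p q \<longrightarrow> forces model (code q) x B \<longrightarrow> forces model (code q) x C)"
    using Imp.prems(2) by (auto simp: model_def decode_code)
  also have "\<dots> \<longleftrightarrow> (\<forall>q. world q \<longrightarrow> acc p q \<longrightarrow> (x, B) \<in> snd q \<longrightarrow> (x, C) \<in> snd q)"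
  proof -
    have "x \<in> lab q" if "acc p q" for q
      using that lab_mono[of p q] Imp.prems(3) by (auto simp: acc_def)
    then show ?thesis using Imp.IH s by auto
  qed
  also have "\<dots> \<longleftrightarrow> (x, Imp B C) \<in> snd p"
  proof
    assume "\<forall>q. world q \<longrightarrow> acc p q \<longrightarrow> (x, B) \<in> snd q \<longrightarrow> (x, C) \<in> snd q"
    then show "(x, Imp B C) \<in> snd p"
      using world_Imp[OF Imp.prems(2,3,1)] by blast
  next
    assume m: "(x, Imp B C) \<in> snd p"
    show "\<forall>q. world q \<longrightarrow> acc p q \<longrightarrow> (x, B) \<in> snd q \<longrightarrow> (x, C) \<in> snd q"
    proof (intro allI impI)
      fix q assume q: "world q" "acc p q" "(x, B) \<in> snd q"
      have "x \<in> lab q" "(x, Imp B C) \<in> snd q"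
        using q(2) lab_mono[of p q] Imp.prems(3) m by (auto simp: acc_def ext_def)
      then show "(x, C) \<in> snd q"
        using local_Imp[of q "{}" x B C] q Imp.prems(1) by (simp add: world_def)
    qed
  qed
  finally show ?case .
next
  case (Box B)
  have s: "B \<in> Sub" using Sub_Box[OF Box.prems(1)] .
  have "forces model (code p) x (Box B) \<longleftrightarrow>
      (\<forall>q. world q \<longrightarrow> acc p q \<longrightarrow> (\<forall>y\<in>lab q. (x, y) \<in> fst q \<longrightarrow> forces model (code q) y B))"
    using Box.prems(2) by (auto simp: model_def decode_code)
  also have "\<dots> \<longleftrightarrow> (\<forall>q. world q \<longrightarrow> acc p q \<longrightarrow> (\<forall>y\<in>lab q. (x, y) \<in> fst q \<longrightarrow> (y, B) \<in> snd q))"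
    using Box.IH s by auto
  also have "\<dots> \<longleftrightarrow> (x, Box B) \<in> snd p"
  proof
    assume "\<forall>q. world q \<longrightarrow> acc p q \<longrightarrow> (\<forall>y\<in>lab q. (x, y) \<in> fst q \<longrightarrow> (y, B) \<in> snd q)"
    then show "(x, Box B) \<in> snd p"
      using world_Box[OF Box.prems(2,3,1)] by blast
  next
    assume m: "(x, Box B) \<in> snd p"
    show "\<forall>q. world q \<longrightarrow> acc p q \<longrightarrow> (\<forall>y\<in>lab q. (x, y) \<in> fst q \<longrightarrow> (y, B) \<in> snd q)"
    proof (intro allI impI ballI)
      fix q y assume q: "world q" "acc p q" and y: "(x, y) \<in> fst q"
      have "x \<in> lab q" "(x, Box B) \<in> snd q"
        using q(2) lab_mono[of p q] Box.prems(3) m by (auto simp: acc_def ext_def)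
      then show "(y, B) \<in> snd q"
        using local_Box[of q "{}" x B y] q y Box.prems(1) by (simp add: world_def)
    qed
  qed
  finally show ?case .
next
  case (Dia B)
  have s: "B \<in> Sub" using Sub_Dia[OF Dia.prems(1)] .
  have pp: "position p" "\<not> pprov {} (seqn p)" using Dia.prems(2) by (simp_all add: world_def)
  have "forces model (code p) x (Dia B) \<longleftrightarrow> (\<exists>y\<in>lab p. (x, y) \<in> fst p \<and> (y, B) \<in> snd p)"
    using Dia.IH[OF s Dia.prems(2)] Dia.prems(2) by (auto simp: model_def decode_code)
  also have "\<dots> \<longleftrightarrow> (x, Dia B) \<in> snd p"
    using local_Dia[OF pp Dia.prems(3,1)] Dia.prems(2) position_in_lab[OF pp(1)]
    unfolding world_def by blast
  finally show ?case .
qed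

lemma not_PIGL_valid:
  assumes p: "position p" "\<not> pprov {} (seqn p)" and A: "A \<in> Sub" "(x0, A) \<notin> snd p"
  shows "\<not> PIGL_valid A"
proof
  assume valid: "PIGL_valid A"
  obtain q where q: "world q" "snd q \<inter> (lab p \<times> Sub) = snd p"
    using saturate[OF p] by blast
  have x0: "x0 \<in> lab r" for r :: "'p pos" by (simp add: lab_def)
  have "(x0, A) \<in> lab p \<times> Sub" using x0 A(1) by simp
  then have "(x0, A) \<notin> snd q" using q(2) A(2) by blast
  then have "\<not> forces model (code q) x0 A" using truth[OF A(1) q(1) x0] by simp
  moreover have "code q \<in> W model" using q(1) by (simp add: model_def)
  moreover have "environment model (code q) (\<lambda>_. x0)"
    using x0 by (simp add: environment_def model_def)
  ultimately show False
    using valid PIGL_model unfolding PIGL_valid_def lsat_def by blast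
qed

end

section \<open>Completeness\<close>

primrec subformulas :: "'p form \<Rightarrow> 'p form set" where
  "subformulas (Atom P) = {Atom P}"
| "subformulas Bot = {Bot}"
| "subformulas (And A B) = insert (And A B) (subformulas A \<union> subformulas B)"
| "subformulas (Or A B) = insert (Or A B) (subformulas A \<union> subformulas B)"
| "subformulas (Imp A B) = insert (Imp A B) (subformulas A \<union> subformulas B)"
| "subformulas (Box A) = insert (Box A) (subformulas A)"
| "subformulas (Dia A) = insert (Dia A) (subformulas A)"

lemma finite_subformulas: "finite (subformulas A)"
  by (induction A) auto

lemma subformulas_refl: "A \<in> subformulas A"
  by (cases A) auto

lemma subformulas_trans: "B \<in> subformulas A \<Longrightarrow> subformulas B \<subseteq> subformulas A"
  by (induction A) auto

lemma exists_infinite_tagging: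
  assumes "finite S"
  shows "\<exists>tag :: nat \<Rightarrow> 'a. \<forall>C\<in>S. infinite {y. tag y = C}"
proof -
  obtain l where l: "set l = S" using finite_list[OF assms] by blast
  \<comment> \<open>Cycling through the list gives each element an arithmetic progression of
    labels.\<close>
  define tag where "tag y = l ! (y mod length l)" for y
  have "infinite {y. tag y = C}" if C: "C \<in> S" for C
  proof -
    obtain k where k: "k < length l" "l ! k = C" using C l by (metis in_set_conv_nth)
    have "range (\<lambda>m. k + m * length l) \<subseteq> {y. tag y = C}"
      using k by (auto simp: tag_def)
    moreover have "inj (\<lambda>m. k + m * length l)" using k(1) by (auto simp: inj_def)
    ultimately show ?thesis using infinite_super range_inj_infinite by blast
  qed
  then show ?thesis by blast
qed

theorem mainTheorem8:
  fixes A :: "'p form" and x :: label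
  assumes "PIGL_valid A"
  shows "mlabIGL_proves x A"
proof (rule ccontr)
  assume no: "\<not> mlabIGL_proves x A"
  obtain tag :: "label \<Rightarrow> 'p form" where tag: "\<forall>C\<in>subformulas A. infinite {y. tag y = C}"
    using exists_infinite_tagging[OF finite_subformulas] by blast
  have sub: "subformulas B \<subseteq> subformulas A" if "B \<in> subformulas A" for B
    using that by (rule subformulas_trans)
  interpret tagged_language x "subformulas A" tag
  proof
    show "B \<in> subformulas A \<and> C \<in> subformulas A" if "And B C \<in> subformulas A" for B C
      using sub[OF that] subformulas_refl[of B] subformulas_refl[of C] by auto
    show "B \<in> subformulas A \<and> C \<in> subformulas A" if "Or B C \<in> subformulas A" for B C
      using sub[OF that] subformulas_refl[of B] subformulas_refl[of C] by auto
    show "B \<in> subformulas A \<and> C \<in> subformulas A" if "Imp B C \<in> subformulas A" for B C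
      using sub[OF that] subformulas_refl[of B] subformulas_refl[of C] by auto
    show "B \<in> subformulas A" if "Box B \<in> subformulas A" for B
      using sub[OF that] subformulas_refl[of B] by auto
    show "B \<in> subformulas A" if "Dia B \<in> subformulas A" for B
      using sub[OF that] subformulas_refl[of B] by auto
  qed (use tag finite_subformulas in auto)
  have "\<not> pprov {} (sseq {} {} {(x, A)})"
    using no pprov_empty_imp_proves by (auto simp: sseq_def)
  \<comment> \<open>The initial position has the root \<open>x\<close> as its only label; completion
    keeps \<open>A\<close> refuted there.\<close>
  then obtain G where G: "G \<subseteq> {x} \<times> subformulas A" "(x, A) \<notin> G"
      "\<not> pprov {} (sseq {} G ({x} \<times> subformulas A - G))"
    using completion[of "{x} \<times> subformulas A" "{}" "{}" "{}" "{(x, A)}"]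
      finite_subformulas[of A] subformulas_refl[of A] by auto
  have "position ({}, G)" using G(1) by (auto simp: position_def lab_def irrefl_def child_def)
  moreover have "\<not> pprov {} (seqn ({}, G))" using G(3) by (simp add: seqn_def lab_def)
  ultimately have "\<not> PIGL_valid A"
    using not_PIGL_valid[of "({}, G)" A] G(2) subformulas_refl[of A] by simp
  then show False using assms by simp
qed

end
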